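(* Let $\mathfrak g$ be a semi-simple Lie algebra of dimension $n$ with Killing form $\kappa$, let $h:\mathfrak g\to\mathbb R$ be a Hamiltonian and let $\theta>0$. Let the noise amplitudes be of the form $\sigma_i=\sigma e_i$, $i=1,\dots,n$, for an arbitrary $\sigma\in\mathbb R$, where the $e_i$ span the underlying vector space of $\mathfrak g$. Consider the dissipative stochastic Euler-Poincaré equation $$d\mu+\mathrm{ad}_{\frac{\partial h}{\partial\mu}}\mu\,dt+\theta\left[\frac{\partial C}{\partial\mu},\left[\frac{\partial C}{\partial\mu},\frac{\partial h}{\partial\mu}\right]\right]dt+\sum_i\mathrm{ad}_{\sigma_i}\mu\circ dW^i_t=0$$ with Casimir $C=\kappa(\mu,\mu)$, and its associated Fokker-Planck equation $$\frac{d}{dt}\mathbb P(\mu)+\{h,\mathbb P\}+\theta\left\langle\left[\frac{\partial\mathbb P}{\partial\mu},\frac{\partial C}{\partial\mu}\right],\left[\frac{\partial h}{\partial\mu},\frac{\partial C}{\partial\mu}\right]\right\rangle-\frac12\sum_i\{\Phi_i,\{\Phi_i,\mathbb P\}\}=0.$$ Then the invariant distribution of this Fokker-Planck equation is given on coadjoint orbits by $$\mathbb P_\infty(\mu)=Z^{-1}e^{-\frac{2\theta}{\sigma^2}h(\mu)},$$ where $Z$ is the normalisation constant that enforces $\int\mathbb P_\infty(\mu)\,d\mu=1$.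
   Context: The Killing form is $\kappa(\xi,\eta)=\langle\xi,\eta\rangle=\mathrm{Tr}(\mathrm{ad}_\xi\mathrm{ad}_\eta)$ for $\xi,\eta\in\mathfrak g$, where $\mathrm{ad}_\xi\eta=[\xi,\eta]$. It is non-degenerate because $\mathfrak g$ is semi-simple, and it is used to identify the dual $\mathfrak g^*$ with $\mathfrak g$; derivatives $\frac{\partial f}{\partial\mu}$ of functions $f:\mathfrak g\to\mathbb R$ are accordingly regarded as elements of $\mathfrak g$. The Lie-Poisson bracket of functions $f,g$ of $\mu\in\mathfrak g$ is $\{f,g\}=\left\langle\mu,\left[\frac{\partial f}{\partial\mu},\frac{\partial g}{\partial\mu}\right]\right\rangle$. A Casimir is a function in the kernel of this bracket; it is constant along solutions of the equation. Coadjoint orbits are the submanifolds, characterised as level sets of Casimirs and parameterised by the initial conditions, on which the motion takes place. $h(\mu)$ is the Hamiltonian associated by the Legendre transform to a reduced Lagrangian $l(\xi)$, $\xi\in\mathfrak g$, with $\mu=\frac{\partial l(\xi)}{\partial\xi}$. The $W^i_t$ are $n$ independent Wiener processes and $\circ$ denotes the Stratonovich integral. The stochastic potentials $\Phi_i:\mathfrak g\to\mathbb R$ are related to the noise amplitudes by $\sigma_i=-\frac{\partial\Phi_i(\mu)}{\partial\mu}$. The constant $\theta>0$ parametrises the rate of energy dissipation. The Fokker-Planck equation describes the time evolution of the probability distribution $\mathbb P$ of the process, where $\mathbb P$ is a normalised real-valued function on $\mathfrak g$; an invariant distribution is a stationary solution of it.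
   Formalization: The Fokker-Planck equation gets the missing term -P div(θ[∂C/∂μ,[∂C/∂μ,∂h/∂μ]]), without which the claim is false; the spanning e_i are normalised by κ(e_i,e_j) = -4δ_ij (so κ is negative definite), and σ ≠ 0. *)

theory Defs
  imports "HOL-Analysis.Analysis"
begin

section \<open>Real Lie algebras\<close>

text \<open>
  The underlying vector space of the Lie algebra is a type \<open>'g\<close> of class \<open>euclidean_space\<close>,
  i.e. an arbitrary real vector space of finite dimension \<open>DIM('g)\<close>.  The inner product of the
  class is auxiliary: it enters only through the topology, the trace and the derivatives,
  which do not depend on it.
\<close>

definition lie_algebra :: "('g::euclidean_space \<Rightarrow> 'g \<Rightarrow> 'g) \<Rightarrow> bool" where
  "lie_algebra br \<longleftrightarrow> bilinear br \<and> (\<forall>x. br x x = 0) \<and>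
     (\<forall>x y z. br x (br y z) + br y (br z x) + br z (br x y) = 0)"

definition lie_ideal :: "('g::euclidean_space \<Rightarrow> 'g \<Rightarrow> 'g) \<Rightarrow> 'g set \<Rightarrow> bool" where
  "lie_ideal br I \<longleftrightarrow> subspace I \<and> (\<forall>x. \<forall>y\<in>I. br x y \<in> I)"

definition derived_algebra :: "('g::euclidean_space \<Rightarrow> 'g \<Rightarrow> 'g) \<Rightarrow> 'g set \<Rightarrow> 'g set" where
  "derived_algebra br S = span {br x y | x y. x \<in> S \<and> y \<in> S}"

definition solvable_subalgebra :: "('g::euclidean_space \<Rightarrow> 'g \<Rightarrow> 'g) \<Rightarrow> 'g set \<Rightarrow> bool" where
  "solvable_subalgebra br S \<longleftrightarrow> (\<exists>k. (derived_algebra br ^^ k) S = {0})"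

definition semisimple_lie_algebra :: "('g::euclidean_space \<Rightarrow> 'g \<Rightarrow> 'g) \<Rightarrow> bool" where
  "semisimple_lie_algebra br \<longleftrightarrow> lie_algebra br \<and>
     (\<forall>I. lie_ideal br I \<and> solvable_subalgebra br I \<longrightarrow> I = {0})"

definition trace_lin :: "('g::euclidean_space \<Rightarrow> 'g) \<Rightarrow> real" where
  "trace_lin L = (\<Sum>b\<in>Basis. L b \<bullet> b)"

definition killing :: "('g::euclidean_space \<Rightarrow> 'g \<Rightarrow> 'g) \<Rightarrow> 'g \<Rightarrow> 'g \<Rightarrow> real" where
  "killing br \<xi> \<eta> = trace_lin (\<lambda>\<zeta>. br \<xi> (br \<eta> \<zeta>))"


section \<open>Calculus on the Lie algebra\<close>

definition C2 :: "('g::euclidean_space \<Rightarrow> real) \<Rightarrow> bool" where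
  "C2 f \<longleftrightarrow> (\<forall>x. f differentiable (at x)) \<and>
     (\<forall>v x. (\<lambda>y. frechet_derivative f (at y) v) differentiable (at x)) \<and>
     (\<forall>u v. continuous_on UNIV
        (\<lambda>x. frechet_derivative (\<lambda>y. frechet_derivative f (at y) v) (at x) u))"

text \<open>
  \<open>grad br f \<mu>\<close> is the derivative \<open>\<partial>f/\<partial>\<mu>\<close>, regarded as an element of the Lie algebra by means
  of the Killing form (and not of the auxiliary inner product).
\<close>

definition grad :: "('g::euclidean_space \<Rightarrow> 'g \<Rightarrow> 'g) \<Rightarrow> ('g \<Rightarrow> real) \<Rightarrow> 'g \<Rightarrow> 'g" where
  "grad br f \<mu> = (THE \<xi>. \<forall>v. killing br \<xi> v = frechet_derivative f (at \<mu>) v)"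

definition divergence :: "('g::euclidean_space \<Rightarrow> 'g) \<Rightarrow> 'g \<Rightarrow> real" where
  "divergence F \<mu> = trace_lin (frechet_derivative F (at \<mu>))"

definition lie_poisson ::
  "('g::euclidean_space \<Rightarrow> 'g \<Rightarrow> 'g) \<Rightarrow> ('g \<Rightarrow> real) \<Rightarrow> ('g \<Rightarrow> real) \<Rightarrow> 'g \<Rightarrow> real" where
  "lie_poisson br f g \<mu> = killing br \<mu> (br (grad br f \<mu>) (grad br g \<mu>))"

definition killing_casimir :: "('g::euclidean_space \<Rightarrow> 'g \<Rightarrow> 'g) \<Rightarrow> 'g \<Rightarrow> real" where
  "killing_casimir br \<mu> = killing br \<mu> \<mu>"


section \<open>Coadjoint orbits\<close>

definition exp_ad :: "('g::euclidean_space \<Rightarrow> 'g \<Rightarrow> 'g) \<Rightarrow> 'g \<Rightarrow> 'g \<Rightarrow> 'g" where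
  "exp_ad br \<xi> \<mu> = (\<Sum>k. (1 / fact k) *\<^sub>R (br \<xi> ^^ k) \<mu>)"

text \<open>
  Under the identification of the dual with the Lie algebra, the coadjoint orbits are the orbits
  of the connected group generated by all \<open>exp (ad \<xi>)\<close>.
\<close>

inductive_set coadjoint_orbit :: "('g::euclidean_space \<Rightarrow> 'g \<Rightarrow> 'g) \<Rightarrow> 'g \<Rightarrow> 'g set"
  for br :: "'g \<Rightarrow> 'g \<Rightarrow> 'g" and \<mu>\<^sub>0 :: 'g where
  base: "\<mu>\<^sub>0 \<in> coadjoint_orbit br \<mu>\<^sub>0"
| step: "\<mu> \<in> coadjoint_orbit br \<mu>\<^sub>0 \<Longrightarrow> exp_ad br \<xi> \<mu> \<in> coadjoint_orbit br \<mu>\<^sub>0"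

text \<open>
  The reference measure \<open>d\<mu>\<close> on an orbit: a nonzero Radon measure carried by the orbit and
  invariant under the group.  It is unique up to a positive factor (the Liouville measure of the
  orbit is one choice), and the factor is absorbed in the normalisation constant.
\<close>

definition orbit_measure ::
  "('g::euclidean_space \<Rightarrow> 'g \<Rightarrow> 'g) \<Rightarrow> 'g set \<Rightarrow> 'g measure \<Rightarrow> bool" where
  "orbit_measure br \<O> m \<longleftrightarrow>
     sets m = sets borel \<and>
     (AE \<mu> in m. \<mu> \<in> \<O>) \<and>
     emeasure m (space m) \<noteq> 0 \<and>
     (\<forall>K. compact K \<longrightarrow> emeasure m K < \<infinity>) \<and>
     (\<forall>\<xi>. distr m borel (exp_ad br \<xi>) = m)"


section \<open>The stochastic equation and its Fokker-Planck equation\<close>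

text \<open>
  A Stratonovich equation \<open>d\<mu> + V\<^sub>0(\<mu>) dt + \<Sum>\<^sub>i V\<^sub>i(\<mu>) \<circ> dW\<^sup>i = 0\<close>, \<open>i = 1, \<dots>, n\<close>, is given by its
  coefficients.  The density \<open>P\<close> of its solution satisfies the Fokker-Planck (forward
  Kolmogorov) equation \<open>dP/dt = div (P V\<^sub>0) + 1/2 \<Sum>\<^sub>i div (div (P V\<^sub>i) V\<^sub>i)\<close>; the first sign is
  positive because the drift of \<open>\<mu>\<close> is \<open>- V\<^sub>0\<close>.
\<close>

definition stratonovich_fokker_planck ::
  "('g::euclidean_space \<Rightarrow> 'g) \<Rightarrow> (nat \<Rightarrow> 'g \<Rightarrow> 'g) \<Rightarrow> nat \<Rightarrow> ('g \<Rightarrow> real) \<Rightarrow> 'g \<Rightarrow> real" where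
  "stratonovich_fokker_planck V\<^sub>0 V n P \<mu> =
     divergence (\<lambda>\<nu>. P \<nu> *\<^sub>R V\<^sub>0 \<nu>) \<mu> +
     1 / 2 * (\<Sum>i\<in>{1..n}.
       divergence (\<lambda>\<nu>. divergence (\<lambda>\<nu>'. P \<nu>' *\<^sub>R V i \<nu>') \<nu> *\<^sub>R V i \<nu>) \<mu>)"

definition dissipative_term ::
  "('g::euclidean_space \<Rightarrow> 'g \<Rightarrow> 'g) \<Rightarrow> ('g \<Rightarrow> real) \<Rightarrow> real \<Rightarrow> ('g \<Rightarrow> real) \<Rightarrow> 'g \<Rightarrow> 'g" where
  "dissipative_term br h \<theta> C \<mu> =
     \<theta> *\<^sub>R br (grad br C \<mu>) (br (grad br C \<mu>) (grad br h \<mu>))"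

text \<open>The coefficients of the dissipative stochastic Euler-Poincare equation.\<close>

definition sep_drift ::
  "('g::euclidean_space \<Rightarrow> 'g \<Rightarrow> 'g) \<Rightarrow> ('g \<Rightarrow> real) \<Rightarrow> real \<Rightarrow> ('g \<Rightarrow> real) \<Rightarrow> 'g \<Rightarrow> 'g" where
  "sep_drift br h \<theta> C \<mu> = br (grad br h \<mu>) \<mu> + dissipative_term br h \<theta> C \<mu>"

definition sep_noise ::
  "('g::euclidean_space \<Rightarrow> 'g \<Rightarrow> 'g) \<Rightarrow> (nat \<Rightarrow> 'g) \<Rightarrow> nat \<Rightarrow> 'g \<Rightarrow> 'g" where
  "sep_noise br s i \<mu> = br (s i) \<mu>"

text \<open>
  The operator \<open>F\<close> in the Fokker-Planck equation \<open>dP/dt + F P = 0\<close>, written with the Lie-Poisson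
  bracket.  The second and third terms together are \<open>- div (P D)\<close>, where \<open>D\<close> is
  \<open>dissipative_term br h \<theta> C\<close>.  The equation has also been written without the third term; but
  \<open>D\<close> is not divergence free, and without this term the equation is neither the forward
  equation of the process nor does it conserve \<open>\<integral>P d\<mu>\<close>, and Gibbs densities do not solve it.

  The constants: since the gradient of \<open>killing_casimir br\<close> is \<open>2 \<mu>\<close>, the dissipation carries a
  factor 4, and with noise amplitudes \<open>\<sigma> e\<^sub>i\<close> the stationary density is \<open>exp (- 2 \<theta> h / \<sigma>\<^sup>2)\<close> when
  \<open>killing br (e\<^sub>i) (e\<^sub>j) = - 4 \<delta>\<^sub>i\<^sub>j\<close>.  Such a basis exists only for a negative definite Killing form.
\<close>

definition fp_operator ::
  "('g::euclidean_space \<Rightarrow> 'g \<Rightarrow> 'g) \<Rightarrow> ('g \<Rightarrow> real) \<Rightarrow> real \<Rightarrow> ('g \<Rightarrow> real) \<Rightarrow>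
   (nat \<Rightarrow> 'g \<Rightarrow> real) \<Rightarrow> ('g \<Rightarrow> real) \<Rightarrow> 'g \<Rightarrow> real" where
  "fp_operator br h \<theta> C \<Phi> P \<mu> =
     lie_poisson br h P \<mu>
     + \<theta> * killing br (br (grad br P \<mu>) (grad br C \<mu>)) (br (grad br h \<mu>) (grad br C \<mu>))
     - P \<mu> * divergence (dissipative_term br h \<theta> C) \<mu>
     - 1 / 2 * (\<Sum>i\<in>{1..DIM('g)}. lie_poisson br (\<Phi> i) (lie_poisson br (\<Phi> i) P) \<mu>)"

definition fp_solution_on ::
  "('g::euclidean_space \<Rightarrow> 'g \<Rightarrow> 'g) \<Rightarrow> ('g \<Rightarrow> real) \<Rightarrow> real \<Rightarrow> ('g \<Rightarrow> real) \<Rightarrow>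
   (nat \<Rightarrow> 'g \<Rightarrow> real) \<Rightarrow> 'g set \<Rightarrow> (real \<Rightarrow> 'g \<Rightarrow> real) \<Rightarrow> bool" where
  "fp_solution_on br h \<theta> C \<Phi> \<O> P \<longleftrightarrow>
     (\<forall>t\<ge>0. C2 (P t)) \<and>
     (\<forall>t\<ge>0. \<forall>\<mu>\<in>\<O>. \<exists>d. ((\<lambda>s. P s \<mu>) has_real_derivative d) (at t within {0..}) \<and>
        d + fp_operator br h \<theta> C \<Phi> (P t) \<mu> = 0)"

definition invariant_distribution_on ::
  "('g::euclidean_space \<Rightarrow> 'g \<Rightarrow> 'g) \<Rightarrow> ('g \<Rightarrow> real) \<Rightarrow> real \<Rightarrow> ('g \<Rightarrow> real) \<Rightarrow>
   (nat \<Rightarrow> 'g \<Rightarrow> real) \<Rightarrow> 'g set \<Rightarrow> 'g measure \<Rightarrow> ('g \<Rightarrow> real) \<Rightarrow> bool" where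
  "invariant_distribution_on br h \<theta> C \<Phi> \<O> m P \<longleftrightarrow>
     fp_solution_on br h \<theta> C \<Phi> \<O> (\<lambda>t. P) \<and>
     integrable m P \<and> (\<integral>\<mu>. P \<mu> \<partial>m) = 1"

end

theory Submission
  imports Defs
begin

text \<open>
  Normalise the basis so that \<open>\<kappa> e\<^sub>i e\<^sub>j = - 4 \<delta>\<^sub>i\<^sub>j\<close>, and let \<open>A\<^sub>i\<close> be the derivation along the
  linear, divergence-free field \<open>[e\<^sub>i, \<mu>]\<close>.  Every field in the equation is a combination of these,
  so \<open>div (\<Sum>\<^sub>i f\<^sub>i [e\<^sub>i, \<mu>]) = \<Sum>\<^sub>i A\<^sub>i f\<^sub>i\<close>.  In particular the dissipation is
  \<open>\<theta> \<Sum>\<^sub>i (A\<^sub>i h) [e\<^sub>i, \<mu>]\<close>, and the Fokker-Planck operator becomes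
  \<open>{h, P} - \<Sum>\<^sub>i A\<^sub>i (\<theta> P A\<^sub>i h + \<sigma>\<^sup>2 / 2 A\<^sub>i P)\<close>.  For \<open>P = G u\<close> with the Gibbs factor
  \<open>G = exp (- 2 \<theta> h / \<sigma>\<^sup>2)\<close> the flux is \<open>\<sigma>\<^sup>2 / 2 G A\<^sub>i u\<close>, which vanishes for constant \<open>u\<close>.

  Conversely, the Killing form is negative definite, so orbits lie in compact spheres, and invariance
  of the orbit measure gives \<open>\<integral> A\<^sub>i f = 0\<close>.  Integrating the stationary equation against \<open>u\<close>
  yields \<open>\<integral> \<Sum>\<^sub>i G (A\<^sub>i u)\<^sup>2 = 0\<close>; since the measure charges every open set meeting the
  orbit, \<open>u\<close> is constant on it.
\<close>

section \<open>Continuously differentiable functions\<close>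

abbreviation ddir :: "('a::euclidean_space \<Rightarrow> real) \<Rightarrow> 'a \<Rightarrow> 'a \<Rightarrow> real" where
  "ddir f x v \<equiv> frechet_derivative f (at x) v"

lemma ddir_eq: "(f has_derivative f') (at x) \<Longrightarrow> ddir f x v = f' v"
  using frechet_derivative_at by metis

lemma has_derivative_ddir: "f differentiable (at x) \<Longrightarrow> (f has_derivative (\<lambda>v. ddir f x v)) (at x)"
  using frechet_derivative_works by auto

lemma linear_ddir: "f differentiable (at x) \<Longrightarrow> linear (ddir f x)"
  by (rule linear_frechet_derivative)

lemma ddir_add:
  "f differentiable (at x) \<Longrightarrow> g differentiable (at x) \<Longrightarrow>
    ddir (\<lambda>x. f x + g x) x v = ddir f x v + ddir g x v"
  by (rule ddir_eq) (intro has_derivative_add has_derivative_ddir)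

lemma ddir_mult:
  "f differentiable (at x) \<Longrightarrow> g differentiable (at x) \<Longrightarrow>
    ddir (\<lambda>x. f x * g x) x v = f x * ddir g x v + ddir f x v * g x"
  by (rule ddir_eq) (intro has_derivative_mult has_derivative_ddir)

lemma ddir_cmult:
  "f differentiable (at x) \<Longrightarrow> ddir (\<lambda>x. c * f x) x v = c * ddir f x v"
  by (rule ddir_eq) (intro has_derivative_mult_right has_derivative_ddir)

lemma ddir_exp_scaled:
  assumes "f differentiable (at x)"
  shows "(\<lambda>x. exp (c * f x)) differentiable (at x)"
    and "ddir (\<lambda>x. exp (c * f x)) x v = exp (c * f x) * (c * ddir f x v)"
proof -
  have d: "((\<lambda>x. exp (c * f x)) has_derivative (\<lambda>v. exp (c * f x) * (c * ddir f x v))) (at x)"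
    by (auto intro!: derivative_eq_intros has_derivative_ddir[OF assms])
  then show "(\<lambda>x. exp (c * f x)) differentiable (at x)"
    by (auto simp: differentiable_def)
  show "ddir (\<lambda>x. exp (c * f x)) x v = exp (c * f x) * (c * ddir f x v)"
    by (rule ddir_eq[OF d])
qed

lemma has_real_derivative_along:
  assumes "f differentiable (at (\<gamma> t))" "(\<gamma> has_vector_derivative w) (at t)"
  shows "((\<lambda>t. f (\<gamma> t)) has_real_derivative ddir f (\<gamma> t) w) (at t)"
proof -
  have "((\<lambda>t. f (\<gamma> t)) has_derivative (\<lambda>r. ddir f (\<gamma> t) (r *\<^sub>R w))) (at t)"
    by (rule has_derivative_compose[OF assms(2)[unfolded has_vector_derivative_def]])
      (rule has_derivative_ddir[OF assms(1)])
  moreover have "ddir f (\<gamma> t) (r *\<^sub>R w) = ddir f (\<gamma> t) w * r" for r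
    using linear_cmul[OF linear_ddir[OF assms(1)]] by simp
  ultimately show ?thesis
    by (simp add: has_field_derivative_def)
qed

text \<open>Asking for continuity of each directional derivative separately matches the form of
  \<open>C2\<close>; in finite dimension it amounts to continuity of the derivative map.\<close>

definition C1 :: "('a::euclidean_space \<Rightarrow> real) \<Rightarrow> bool" where
  "C1 f \<longleftrightarrow> (\<forall>x. f differentiable (at x)) \<and> (\<forall>v. continuous_on UNIV (\<lambda>x. ddir f x v))"

lemma C1_differentiable: "C1 f \<Longrightarrow> f differentiable (at x)"
  by (simp add: C1_def)

lemma C1_continuous: "C1 f \<Longrightarrow> continuous_on S f"
  by (meson C1_def continuous_at_imp_continuous_on differentiable_imp_continuous_within)

lemma C1_continuous_ddir: "C1 f \<Longrightarrow> continuous_on S (\<lambda>x. ddir f x v)"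
  unfolding C1_def using continuous_on_subset by blast

lemma C1_I:
  assumes "\<And>x. (f has_derivative f' x) (at x)" "\<And>v. continuous_on UNIV (\<lambda>x. f' x v)"
  shows "C1 f"
  unfolding C1_def differentiable_def using assms(1) assms(2) ddir_eq[OF assms(1)] by auto

lemma C1_has_derivative: "C1 f \<Longrightarrow> (f has_derivative (\<lambda>v. ddir f x v)) (at x)"
  by (intro has_derivative_ddir C1_differentiable)

lemma C1_const: "C1 (\<lambda>x. c)"
  by (simp add: C1_def)

lemma C1_linear: "linear f \<Longrightarrow> C1 f"
  by (rule C1_I[where f' = "\<lambda>x. f"])
    (auto intro: bounded_linear_imp_has_derivative simp: linear_conv_bounded_linear)

lemma C1_mult: "C1 f \<Longrightarrow> C1 g \<Longrightarrow> C1 (\<lambda>x. f x * g x)"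
  by (rule C1_I, rule has_derivative_mult)
    (auto intro!: continuous_intros intro: C1_has_derivative C1_continuous C1_continuous_ddir)

lemma C1_sum: "(\<And>i. i \<in> I \<Longrightarrow> C1 (f i)) \<Longrightarrow> C1 (\<lambda>x. \<Sum>i\<in>I. f i x)"
  by (rule C1_I, rule has_derivative_sum)
    (auto intro!: C1_has_derivative continuous_intros C1_continuous_ddir)

lemma C1_add: "C1 f \<Longrightarrow> C1 g \<Longrightarrow> C1 (\<lambda>x. f x + g x)"
  by (rule C1_I, rule has_derivative_add)
    (auto intro!: C1_has_derivative continuous_intros C1_continuous_ddir)

lemma C1_cmult: "C1 f \<Longrightarrow> C1 (\<lambda>x. c * f x)"
  by (intro C1_mult C1_const)

lemma C1_exp_scaled: "C1 f \<Longrightarrow> C1 (\<lambda>x. exp (c * f x))"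
  by (rule C1_I, rule has_derivative_exp, rule has_derivative_mult_right)
    (auto intro!: continuous_intros intro: C1_has_derivative C1_continuous C1_continuous_ddir)

lemma C2_differentiable: "C2 f \<Longrightarrow> f differentiable (at x)"
  by (simp add: C2_def)

lemma C2_imp_C1_ddir: "C2 f \<Longrightarrow> C1 (\<lambda>x. ddir f x v)"
  by (simp add: C2_def C1_def)

lemma C2_imp_C1: "C2 f \<Longrightarrow> C1 f"
  unfolding C1_def
  by (auto intro: C2_differentiable C1_continuous C2_imp_C1_ddir)

lemma C2_I:
  assumes "\<And>x. f differentiable (at x)" "\<And>v. C1 (\<lambda>x. ddir f x v)"
  shows "C2 f"
  using assms by (simp add: C2_def C1_def)

lemma C2_exp_scaled:
  assumes "C2 f"
  shows "C2 (\<lambda>x. exp (c * f x))"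
proof (rule C2_I)
  show "(\<lambda>x. exp (c * f x)) differentiable (at x)" for x
    by (rule ddir_exp_scaled[OF C2_differentiable[OF assms]])
  show "C1 (\<lambda>x. ddir (\<lambda>x. exp (c * f x)) x v)" for v
    unfolding ddir_exp_scaled(2)[OF C2_differentiable[OF assms]]
    by (intro C1_mult C1_const C1_exp_scaled C2_imp_C1 C2_imp_C1_ddir assms)
qed

lemma C2_mult:
  assumes "C2 f" "C2 g"
  shows "C2 (\<lambda>x. f x * g x)"
proof (rule C2_I)
  show "(\<lambda>x. f x * g x) differentiable (at x)" for x
    by (intro differentiable_mult C2_differentiable assms)
  show "C1 (\<lambda>x. ddir (\<lambda>x. f x * g x) x v)" for v
    unfolding ddir_mult[OF C2_differentiable[OF assms(1)] C2_differentiable[OF assms(2)]]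
    by (intro C1_mult C1_add C2_imp_C1 C2_imp_C1_ddir assms)
qed

lemma C2_const: "C2 (\<lambda>x. c)"
  by (rule C2_I) (auto simp: C1_const)

section \<open>Symmetry of second derivatives\<close>

lemma second_difference_mvt:
  assumes f: "C2 f" and t: "0 < t"
  obtains a b where "0 < a" "a < t" "0 < b" "b < t"
    "f (x + t *\<^sub>R u + t *\<^sub>R v) - f (x + t *\<^sub>R u) - f (x + t *\<^sub>R v) + f x
      = t\<^sup>2 * ddir (\<lambda>y. ddir f y u) (x + a *\<^sub>R u + b *\<^sub>R v) v"
proof -
  have d1: "((\<lambda>r. f (y + r *\<^sub>R w)) has_real_derivative ddir f (y + r *\<^sub>R w) w) (at r)" for y w r
    by (rule has_real_derivative_along[OF C2_differentiable[OF f]])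
      (auto intro!: derivative_eq_intros)
  have d2: "((\<lambda>r. ddir f (y + r *\<^sub>R w) u) has_real_derivative
      ddir (\<lambda>y. ddir f y u) (y + r *\<^sub>R w) w) (at r)" for y w r
    by (rule has_real_derivative_along[where f = "\<lambda>y. ddir f y u",
          OF C1_differentiable[OF C2_imp_C1_ddir[OF f]]])
      (auto intro!: derivative_eq_intros)
  \<comment> \<open>The mean value theorem is first applied in direction \<open>u\<close>, to the
    difference of \<open>f\<close> along two parallel segments a shift \<open>t *\<^sub>R v\<close>
    apart; the second application moves in direction \<open>v\<close>.\<close>
  have "\<exists>a. 0 < a \<and> a < t \<and>
      (f ((x + t *\<^sub>R v) + t *\<^sub>R u) - f (x + t *\<^sub>R u)) - (f ((x + t *\<^sub>R v) + 0 *\<^sub>R u) - f (x + 0 *\<^sub>R u))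
      = (t - 0) * (ddir f ((x + t *\<^sub>R v) + a *\<^sub>R u) u - ddir f (x + a *\<^sub>R u) u)"
    by (rule MVT2[OF t]) (intro DERIV_diff d1)
  then obtain a where a: "0 < a" "a < t"
    "f (x + t *\<^sub>R u + t *\<^sub>R v) - f (x + t *\<^sub>R u) - f (x + t *\<^sub>R v) + f x
      = t * (ddir f (x + a *\<^sub>R u + t *\<^sub>R v) u - ddir f (x + a *\<^sub>R u) u)"
    by (auto simp: algebra_simps)
  have "\<exists>b. 0 < b \<and> b < t \<and>
      ddir f ((x + a *\<^sub>R u) + t *\<^sub>R v) u - ddir f ((x + a *\<^sub>R u) + 0 *\<^sub>R v) u
      = (t - 0) * ddir (\<lambda>y. ddir f y u) ((x + a *\<^sub>R u) + b *\<^sub>R v) v"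
    by (rule MVT2[OF t]) (rule d2)
  then obtain b where "0 < b" "b < t"
    "ddir f (x + a *\<^sub>R u + t *\<^sub>R v) u - ddir f (x + a *\<^sub>R u) u
      = t * ddir (\<lambda>y. ddir f y u) (x + a *\<^sub>R u + b *\<^sub>R v) v"
    by auto
  with a show thesis
    by (intro that[of a b]) (auto simp: power2_eq_square)
qed

text \<open>The intermediate points of the mean value theorem tend to \<open>x\<close>, where the
  mixed derivative is continuous.\<close>

lemma second_difference_quotient_limit:
  assumes f: "C2 f"
  shows "(\<lambda>n. let t = 1 / real (Suc n) in
      (f (x + t *\<^sub>R u + t *\<^sub>R v) - f (x + t *\<^sub>R u) - f (x + t *\<^sub>R v) + f x) / t\<^sup>2)
    \<longlonglongrightarrow> ddir (\<lambda>y. ddir f y u) x v"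
proof -
  define t where "t = (\<lambda>n. 1 / real (Suc n))"
  have t: "0 < t n" for n by (simp add: t_def)
  have t0: "t \<longlonglongrightarrow> 0"
    unfolding t_def using LIMSEQ_inverse_real_of_nat by (simp add: inverse_eq_divide)
  let ?\<Delta> = "\<lambda>t. f (x + t *\<^sub>R u + t *\<^sub>R v) - f (x + t *\<^sub>R u) - f (x + t *\<^sub>R v) + f x"
  let ?H = "\<lambda>y. ddir (\<lambda>y. ddir f y u) y v"
  have "\<exists>a b. 0 < a \<and> a < t n \<and> 0 < b \<and> b < t n \<and>
      ?\<Delta> (t n) = (t n)\<^sup>2 * ?H (x + a *\<^sub>R u + b *\<^sub>R v)" for n
    using second_difference_mvt[OF f t[of n], of x u v] by metis
  then obtain a b where ab: "\<And>n. 0 < a n" "\<And>n. a n < t n" "\<And>n. 0 < b n" "\<And>n. b n < t n"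
    "\<And>n. ?\<Delta> (t n) = (t n)\<^sup>2 * ?H (x + a n *\<^sub>R u + b n *\<^sub>R v)"
    by metis
  have "a \<longlonglongrightarrow> 0" "b \<longlonglongrightarrow> 0"
    by (rule real_tendsto_sandwich[OF _ _ tendsto_const t0];
        auto intro!: always_eventually less_imp_le ab)+
  then have "(\<lambda>n. x + a n *\<^sub>R u + b n *\<^sub>R v) \<longlonglongrightarrow> x + 0 *\<^sub>R u + 0 *\<^sub>R v"
    by (intro tendsto_intros)
  moreover have "isCont ?H x"
    using C1_continuous_ddir[OF C2_imp_C1_ddir[OF f]] continuous_on_eq_continuous_at[OF open_UNIV]
    by blast
  ultimately have "(\<lambda>n. ?H (x + a n *\<^sub>R u + b n *\<^sub>R v)) \<longlonglongrightarrow> ?H x"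
    by (intro isCont_tendsto_compose[of x ?H]) auto
  moreover have "?\<Delta> (t n) / (t n)\<^sup>2 = ?H (x + a n *\<^sub>R u + b n *\<^sub>R v)" for n
    using ab(5)[of n] t[of n] by simp
  ultimately show ?thesis
    by (simp add: t_def Let_def)
qed

text \<open>The second difference does not change when \<open>u\<close> and \<open>v\<close> are
  exchanged, so both mixed derivatives are limits of the same quotients.\<close>

lemma second_derivative_symmetric:
  assumes "C2 f"
  shows "ddir (\<lambda>y. ddir f y u) x v = ddir (\<lambda>y. ddir f y v) x u"
proof (rule LIMSEQ_unique[OF second_difference_quotient_limit[OF assms]])
  have "x + t *\<^sub>R v + t *\<^sub>R u = x + t *\<^sub>R u + t *\<^sub>R v" for t :: real
    by (simp add: algebra_simps)
  then have "(let t = 1 / real (Suc n) in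
      (f (x + t *\<^sub>R u + t *\<^sub>R v) - f (x + t *\<^sub>R u) - f (x + t *\<^sub>R v) + f x) / t\<^sup>2)
    = (let t = 1 / real (Suc n) in
      (f (x + t *\<^sub>R v + t *\<^sub>R u) - f (x + t *\<^sub>R v) - f (x + t *\<^sub>R u) + f x) / t\<^sup>2)" for n
    by (simp add: Let_def algebra_simps)
  then show "(\<lambda>n. let t = 1 / real (Suc n) in
      (f (x + t *\<^sub>R u + t *\<^sub>R v) - f (x + t *\<^sub>R u) - f (x + t *\<^sub>R v) + f x) / t\<^sup>2)
    \<longlonglongrightarrow> ddir (\<lambda>y. ddir f y v) x u"
    using second_difference_quotient_limit[OF assms, of x v u] by presburger
qed

section \<open>Traces and the Killing form\<close>

lemma trace_lin_add: "trace_lin (\<lambda>x. L x + M x) = trace_lin L + trace_lin M"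
  by (simp add: trace_lin_def inner_add_left sum.distrib)

lemma trace_lin_diff: "trace_lin (\<lambda>x. L x - M x) = trace_lin L - trace_lin M"
  by (simp add: trace_lin_def inner_diff_left sum_subtractf)

lemma trace_lin_scaleR: "trace_lin (\<lambda>x. c *\<^sub>R L x) = c * trace_lin L"
  by (simp add: trace_lin_def sum_distrib_left)

lemma trace_lin_sum: "trace_lin (\<lambda>x. \<Sum>i\<in>I. L i x) = (\<Sum>i\<in>I. trace_lin (L i))"
  unfolding trace_lin_def inner_sum_left by (rule sum.swap)

text \<open>This lets a trace be read off from any splitting into rank-one maps, not only from the
  standard basis.\<close>

lemma trace_lin_rank_one:
  fixes w :: "'a::euclidean_space"
  assumes "linear \<phi>"
  shows "trace_lin (\<lambda>x. \<phi> x *\<^sub>R w) = \<phi> w"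
proof -
  have "\<phi> w = \<phi> (\<Sum>b\<in>Basis. (w \<bullet> b) *\<^sub>R b)"
    by (simp add: euclidean_representation)
  also have "\<dots> = (\<Sum>b\<in>Basis. (w \<bullet> b) * \<phi> b)"
    using assms by (simp add: linear_sum linear_cmul)
  finally show ?thesis
    by (simp add: trace_lin_def mult.commute)
qed

text \<open>Expanding \<open>M x\<close> in the basis splits \<open>L (M x)\<close> into rank-one
  maps, whose traces are the diagonal entries of the opposite product.\<close>

lemma trace_lin_comp_commute:
  fixes L M :: "'a::euclidean_space \<Rightarrow> 'a"
  assumes "linear L" "linear M"
  shows "trace_lin (\<lambda>x. L (M x)) = trace_lin (\<lambda>x. M (L x))"
proof -
  have "trace_lin (\<lambda>x. L (M x)) = trace_lin (\<lambda>x. \<Sum>b\<in>Basis. (M x \<bullet> b) *\<^sub>R L b)"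
    unfolding linear_cmul[OF assms(1), symmetric] linear_sum[OF assms(1), symmetric]
    by (simp add: euclidean_representation)
  also have "\<dots> = (\<Sum>b\<in>Basis. M (L b) \<bullet> b)"
    unfolding trace_lin_sum
    by (intro sum.cong refl trace_lin_rank_one linear_compose[OF assms(2), unfolded o_def])
      (auto intro!: linearI simp: inner_add_left)
  finally show ?thesis
    by (simp add: trace_lin_def)
qed

lemma divergence_sum:
  assumes "\<And>i. i \<in> I \<Longrightarrow> F i differentiable (at x)"
  shows "divergence (\<lambda>y. \<Sum>i\<in>I. F i y) x = (\<Sum>i\<in>I. divergence (F i) x)"
proof -
  have "((\<lambda>y. \<Sum>i\<in>I. F i y) has_derivative (\<lambda>v. \<Sum>i\<in>I. frechet_derivative (F i) (at x) v)) (at x)"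
    using assms by (intro has_derivative_sum) (auto simp: frechet_derivative_works)
  then have "frechet_derivative (\<lambda>y. \<Sum>i\<in>I. F i y) (at x)
      = (\<lambda>v. \<Sum>i\<in>I. frechet_derivative (F i) (at x) v)"
    using frechet_derivative_at by metis
  then show ?thesis
    by (simp add: divergence_def trace_lin_sum)
qed

lemma divergence_add:
  assumes "F differentiable (at x)" "G differentiable (at x)"
  shows "divergence (\<lambda>y. F y + G y) x = divergence F x + divergence G x"
  using divergence_sum[where I = "UNIV :: bool set" and F = "\<lambda>b. if b then F else G" and x = x] assms
  by (simp add: UNIV_bool add.commute)

section \<open>Lie algebras with a frame orthogonal for a negative definite Killing form\<close>

locale killing_frame =
  fixes br :: "'g::euclidean_space \<Rightarrow> 'g \<Rightarrow> 'g" and e :: "'i \<Rightarrow> 'g" and I :: "'i set"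
  assumes lie: "lie_algebra br"
    and finite_I: "finite I"
    and span_e: "span (e ` I) = UNIV"
    and killing_e: "\<And>i j. i \<in> I \<Longrightarrow> j \<in> I \<Longrightarrow> killing br (e i) (e j) = (if i = j then - 4 else 0)"
begin

abbreviation \<kappa> :: "'g \<Rightarrow> 'g \<Rightarrow> real" where "\<kappa> \<equiv> killing br"

sublocale br: bounded_bilinear br
  using lie by (simp add: lie_algebra_def bilinear_conv_bounded_bilinear)

lemma linear_br_right: "linear (br x)"
  using br.bounded_linear_right linear_conv_bounded_linear by blast

lemma linear_br_left: "linear (\<lambda>x. br x y)"
  using br.bounded_linear_left linear_conv_bounded_linear by blast

lemma br_self: "br x x = 0"
  using lie by (simp add: lie_algebra_def)

lemma br_skew: "br x y = - br y x"
proof -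
  have "br (x + y) (x + y) = br x y + br y x"
    by (simp only: br.add_left br.add_right) (simp add: br_self)
  then show ?thesis
    by (metis br_self eq_neg_iff_add_eq_0)
qed

text \<open>The Jacobi identity, in the form that \<open>ad\<close> is a representation.\<close>

lemma br_br_left: "br (br x y) z = br x (br y z) - br y (br x z)"
proof -
  have "br x (br y z) + br y (br z x) + br z (br x y) = 0"
    using lie by (simp add: lie_algebra_def)
  then show ?thesis
    using br_skew[of "br x y" z] br_skew[of z x] by (simp add: br.minus_right algebra_simps)
qed

lemma killing_commute: "\<kappa> x y = \<kappa> y x"
  unfolding killing_def by (rule trace_lin_comp_commute) (rule linear_br_right)+

lemma killing_add_left: "\<kappa> (x + y) z = \<kappa> x z + \<kappa> y z"
  by (simp add: killing_def br.add_left trace_lin_add)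

lemma killing_scaleR_left: "\<kappa> (c *\<^sub>R x) z = c * \<kappa> x z"
  by (simp add: killing_def br.scaleR_left trace_lin_scaleR)

sublocale killing: bounded_bilinear \<kappa>
proof -
  have "linear (\<lambda>x. \<kappa> x z)" for z
    by (rule linearI) (simp_all add: killing_add_left killing_scaleR_left)
  then have "bilinear \<kappa>"
    unfolding bilinear_def using killing_commute by (metis (no_types, lifting) ext)
  then show "bounded_bilinear \<kappa>"
    by (simp add: bilinear_conv_bounded_bilinear)
qed

lemma linear_killing_left: "linear (\<lambda>x. \<kappa> x z)"
  using killing.bounded_linear_left linear_conv_bounded_linear by blast

text \<open>The Jacobi identity splits each side into two traces of triple products. One is common
  to both sides; the other two agree by cyclicity.\<close>

lemma killing_invariant: "\<kappa> (br x y) z = \<kappa> x (br y z)"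
proof -
  let ?T = "\<lambda>x y z. trace_lin (\<lambda>w. br x (br y (br z w)))"
  have "\<kappa> (br x y) z = ?T x y z - ?T y x z"
    by (simp add: killing_def br_br_left trace_lin_diff)
  moreover have "\<kappa> x (br y z) = ?T x y z - ?T x z y"
    by (simp add: killing_def br_br_left br.diff_right trace_lin_diff)
  moreover have "?T y x z = ?T x z y"
    using trace_lin_comp_commute[OF linear_br_right[of y]
        linear_compose[OF linear_br_right[of z] linear_br_right[of x]]]
    by (simp add: o_def)
  ultimately show ?thesis
    by simp
qed

lemma killing_br_swap: "\<kappa> (br x y) z = - \<kappa> y (br x z)"
  using killing_invariant[of y x z] br_skew[of x y] by (simp add: killing.minus_left)

text \<open>Both sides are linear in \<open>x\<close>, and on frame vectors the factor
  \<open>- 1 / 4\<close> cancels the Gram value \<open>- 4\<close>. Later frame formulas arise by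
  applying a linear map to this sum.\<close>

lemma expansion: "x = (\<Sum>i\<in>I. (- 1 / 4 * \<kappa> x (e i)) *\<^sub>R e i)"
proof -
  let ?E = "\<lambda>x. \<Sum>i\<in>I. (- 1 / 4 * \<kappa> x (e i)) *\<^sub>R e i"
  have "linear ?E"
    by (intro linear_compose_sum ballI linearI)
      (simp_all add: killing.add_left killing.scaleR_left scaleR_add_left scaleR_diff_left
        add_divide_distrib)
  moreover have "?E b = id b" if "b \<in> e ` I" for b
  proof -
    from that obtain j where j: "j \<in> I" "b = e j" by blast
    then have "?E b = (\<Sum>i\<in>I. if i = j then e i else 0)"
      by (intro sum.cong) (auto simp: killing_e)
    then show ?thesis
      using j finite_I by simp
  qed
  ultimately have "?E x = id x"
    using linear_eq_on_span[OF _ linear_id, of ?E "e ` I" x] unfolding span_e by blast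
  then show ?thesis
    by (simp only: id_apply)
qed

lemma linear_expansion:
  assumes "linear \<phi>"
  shows "\<phi> x = (\<Sum>i\<in>I. (- 1 / 4 * \<kappa> x (e i)) *\<^sub>R \<phi> (e i))"
proof -
  have "\<phi> x = \<phi> (\<Sum>i\<in>I. (- 1 / 4 * \<kappa> x (e i)) *\<^sub>R e i)"
    by (simp only: expansion[of x, symmetric])
  then show ?thesis
    by (simp only: linear_sum[OF assms] linear_cmul[OF assms])
qed

lemma linear_expansion_real:
  assumes "linear \<phi>"
  shows "\<phi> x = - 1 / 4 * (\<Sum>i\<in>I. \<kappa> x (e i) * \<phi> (e i))"
  using linear_expansion[OF assms, of x] by (simp only: sum_distrib_left real_scaleR_def mult.assoc)

lemma killing_expansion: "\<kappa> x y = - 1 / 4 * (\<Sum>i\<in>I. \<kappa> x (e i) * \<kappa> y (e i))"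
  using linear_expansion_real[OF linear_killing_left, of x y]
  by (simp only: killing_commute[of _ y])

text \<open>Non-degeneracy: the pairings with the frame are the coefficients of the
  expansion.\<close>

lemma killing_eqI:
  assumes "\<And>v. \<kappa> x v = \<kappa> y v"
  shows "x = y"
proof -
  have "(\<Sum>i\<in>I. (- 1 / 4 * \<kappa> x (e i)) *\<^sub>R e i) = (\<Sum>i\<in>I. (- 1 / 4 * \<kappa> y (e i)) *\<^sub>R e i)"
    by (simp only: assms)
  then show ?thesis
    by (simp only: expansion[symmetric])
qed

text \<open>Definiteness: in the frame, \<open>\<kappa> x x\<close> is \<open>- 1 / 4\<close> times
  a sum of squares.\<close>

lemma killing_zero_imp:
  assumes "\<kappa> x x = 0"
  shows "x = 0"
proof -
  have "(\<Sum>i\<in>I. (\<kappa> x (e i))\<^sup>2) = 0"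
    using killing_expansion[of x x] assms by (simp add: power2_eq_square)
  then have "\<kappa> x (e i) = 0" if "i \<in> I" for i
    using that finite_I by (simp add: sum_nonneg_eq_0_iff)
  then have "(\<Sum>i\<in>I. (- 1 / 4 * \<kappa> x (e i)) *\<^sub>R e i) = 0"
    by simp
  then show ?thesis
    by (simp only: expansion[of x, symmetric])
qed

text \<open>A level set of a definite form: closed by continuity, bounded because its value bounds
  every frame coefficient.\<close>

lemma compact_killing_sphere: "compact {x. \<kappa> x x = r}"
proof -
  have "closed {x. \<kappa> x x = r}"
    by (intro closed_Collect_eq killing.continuous_on continuous_on_id continuous_on_const)
  moreover have "bounded {x. \<kappa> x x = r}"
  proof (rule boundedI)
    fix x assume "x \<in> {x. \<kappa> x x = r}"
    then have s: "(\<Sum>i\<in>I. (\<kappa> x (e i))\<^sup>2) = - 4 * r"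
      using killing_expansion[of x x] by (simp add: power2_eq_square)
    \<comment> \<open>Since \<open>x\<close> lies in the set, \<open>- 4 * r\<close> is a sum of
      squares, so the root is taken of a nonnegative number.\<close>
    have *: "\<bar>\<kappa> x (e i)\<bar> \<le> sqrt (- 4 * r)" if "i \<in> I" for i
    proof -
      have "(\<kappa> x (e i))\<^sup>2 \<le> - 4 * r"
        unfolding s[symmetric] using that finite_I by (intro member_le_sum) auto
      then show ?thesis
        using real_sqrt_le_mono by fastforce
    qed
    have "\<bar>- 1 / 4 * \<kappa> x (e i)\<bar> \<le> sqrt (- 4 * r)" if "i \<in> I" for i
    proof -
      have "\<bar>- 1 / 4 * \<kappa> x (e i)\<bar> \<le> \<bar>\<kappa> x (e i)\<bar>"
        by (simp add: abs_mult)
      also have "\<dots> \<le> sqrt (- 4 * r)"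
        by (rule *[OF that])
      finally show ?thesis .
    qed
    then have "norm (\<Sum>i\<in>I. (- 1 / 4 * \<kappa> x (e i)) *\<^sub>R e i) \<le> (\<Sum>i\<in>I. sqrt (- 4 * r) * norm (e i))"
      by (intro sum_norm_le) (simp only: norm_scaleR mult_right_mono norm_ge_zero)
    then show "norm x \<le> (\<Sum>i\<in>I. sqrt (- 4 * r) * norm (e i))"
      by (simp only: expansion[of x, symmetric])
  qed
  ultimately show ?thesis
    by (simp add: compact_eq_bounded_closed)
qed

text \<open>The frame is orthogonal for the Killing form and \<open>br x\<close> is skew for it.\<close>

lemma trace_br: "trace_lin (br x) = 0"
proof -
  have "trace_lin (br x) = trace_lin (\<lambda>y. \<Sum>i\<in>I. (- 1 / 4 * \<kappa> y (e i)) *\<^sub>R br x (e i))"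
    by (rule arg_cong[where f = trace_lin]) (rule ext, rule linear_expansion[OF linear_br_right])
  also have "\<dots> = (\<Sum>i\<in>I. - 1 / 4 * \<kappa> (br x (e i)) (e i))"
    unfolding trace_lin_sum
    by (intro sum.cong refl trace_lin_rank_one)
      (auto intro!: linearI simp: killing.add_left killing.scaleR_left algebra_simps)
  also have "\<dots> = 0"
    by (simp add: killing_invariant br_self killing.zero_right)
  finally show ?thesis .
qed

section \<open>Gradients and vector fields along adjoint orbits\<close>

text \<open>The element with frame coefficients \<open>- 1 / 4 * ddir f x (e i)\<close> represents
  the derivative, and non-degeneracy makes it the only one, so the definite description in
  \<open>grad\<close> denotes it.\<close>

lemma killing_grad:
  assumes "f differentiable (at x)"
  shows "\<kappa> (grad br f x) v = ddir f x v"
proof -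
  define \<xi> where "\<xi> = (\<Sum>i\<in>I. (- 1 / 4 * ddir f x (e i)) *\<^sub>R e i)"
  have *: "\<kappa> \<xi> v = ddir f x v" for v
    unfolding linear_expansion[OF linear_ddir[OF assms], of v] \<xi>_def killing.sum_left
      killing.scaleR_left killing_commute[of v] real_scaleR_def by (simp only: mult.commute mult.left_commute)
  then have "grad br f x = \<xi>"
    unfolding grad_def by (rule_tac the_equality) (auto intro: killing_eqI)
  with * show ?thesis by (simp only:)
qed

lemma grad_eqI:
  assumes "f differentiable (at x)" "\<And>v. ddir f x v = \<kappa> y v"
  shows "grad br f x = y"
  using assms killing_grad by (intro killing_eqI) simp

text \<open>Symmetry of the form doubles the derivative. The gradient occurs twice in the
  dissipation, which therefore acquires a factor 4.\<close>

lemma grad_casimir: "grad br (killing_casimir br) x = 2 *\<^sub>R x"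
proof -
  have d: "(killing_casimir br has_derivative (\<lambda>v. \<kappa> x v + \<kappa> v x)) (at x)"
    unfolding killing_casimir_def[abs_def]
    by (auto intro!: derivative_eq_intros killing.FDERIV)
  show ?thesis
    by (rule grad_eqI)
      (use d in \<open>auto simp: differentiable_def ddir_eq[OF d] killing.scaleR_left killing_commute[of _ x]\<close>)
qed

text \<open>The derivation \<open>A\<^sub>i\<close>: the field \<open>br (e i) x\<close> generates
  the one-parameter group \<open>exp (t ad (e i))\<close>, so it is tangent to the orbits.\<close>

definition along :: "'i \<Rightarrow> ('g \<Rightarrow> real) \<Rightarrow> 'g \<Rightarrow> real" where
  "along i f x = ddir f x (br (e i) x)"

lemma along_mult:
  "f differentiable (at x) \<Longrightarrow> g differentiable (at x) \<Longrightarrow>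
    along i (\<lambda>x. f x * g x) x = f x * along i g x + along i f x * g x"
  by (simp add: along_def ddir_mult)

lemma along_add:
  "f differentiable (at x) \<Longrightarrow> g differentiable (at x) \<Longrightarrow>
    along i (\<lambda>x. f x + g x) x = along i f x + along i g x"
  by (simp add: along_def ddir_add)

lemma along_cmult:
  "f differentiable (at x) \<Longrightarrow> along i (\<lambda>x. c * f x) x = c * along i f x"
  by (simp add: along_def ddir_cmult)

lemma along_const: "along i (\<lambda>x. c) x = 0"
  by (simp add: along_def)

text \<open>Expanding \<open>y\<close> in the frame shows that the \<open>along i f\<close> control
  every derivative tangent to an orbit.\<close>

lemma ddir_br:
  assumes "f differentiable (at x)"
  shows "ddir f x (br y x) = - 1 / 4 * (\<Sum>i\<in>I. \<kappa> y (e i) * along i f x)"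
proof -
  have "linear (\<lambda>y. ddir f x (br y x))"
    using linear_compose[OF linear_br_left linear_ddir[OF assms]] by (simp add: o_def)
  from linear_expansion_real[OF this, of y] show ?thesis
    by (simp only: along_def)
qed

text \<open>By invariance of the Killing form, these derivatives are the frame pairings of
  \<open>br x (grad br f x)\<close>; this is what turns the double bracket into a frame sum.\<close>

lemma along_killing_grad:
  "f differentiable (at x) \<Longrightarrow> along i f x = \<kappa> (br x (grad br f x)) (e i)"
  using killing_grad[of f x "br (e i) x"] killing_invariant[of "e i" x "grad br f x"]
  by (simp add: along_def killing_commute)

lemma along_sq_sum:
  assumes "f differentiable (at x)"
  shows "(\<Sum>i\<in>I. along i f x *\<^sub>R br (e i) x) = 4 *\<^sub>R br x (br x (grad br f x))"
proof -
  have "br (br x (grad br f x)) x = (\<Sum>i\<in>I. (- 1 / 4 * along i f x) *\<^sub>R br (e i) x)"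
    using linear_expansion[OF linear_br_left, of "br x (grad br f x)" x]
    by (simp only: along_killing_grad[OF assms])
  then have "4 *\<^sub>R br x (br x (grad br f x)) = (\<Sum>i\<in>I. along i f x *\<^sub>R br (e i) x)"
    using br_skew[of x "br x (grad br f x)"]
    by (simp add: scaleR_sum_right sum_negf[symmetric])
  then show ?thesis by simp
qed

text \<open>The direction \<open>br (e i) x\<close> moves with \<open>x\<close>, whereas
  \<open>C1\<close> and \<open>C2\<close> speak of fixed directions; the expansion reduces
  regularity to the latter.\<close>

lemma along_Basis:
  assumes "f differentiable (at x)"
  shows "along i f x = (\<Sum>b\<in>Basis. (br (e i) x \<bullet> b) * ddir f x b)"
proof -
  have "along i f x = ddir f x (\<Sum>b\<in>Basis. (br (e i) x \<bullet> b) *\<^sub>R b)"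
    by (simp add: along_def euclidean_representation)
  then show ?thesis
    using linear_ddir[OF assms] by (simp add: linear_sum linear_cmul)
qed

lemma C1_along:
  assumes "C2 f"
  shows "C1 (along i f)"
proof -
  have "C1 (\<lambda>x. br (e i) x \<bullet> b)" for b
    by (intro C1_linear linearI) (simp_all add: br.add_right br.scaleR_right inner_add_left)
  then show ?thesis
    unfolding along_Basis[OF C2_differentiable[OF assms], abs_def]
    by (intro C1_sum C1_mult C2_imp_C1_ddir assms)
qed

lemma continuous_along:
  assumes "C1 f"
  shows "continuous_on UNIV (along i f)"
  unfolding along_Basis[OF C1_differentiable[OF assms], abs_def]
  by (intro continuous_intros br.continuous_on C1_continuous_ddir assms)

text \<open>The Hessian is symmetric, whereas \<open>\<kappa> x (br (e i) (e j))\<close> is skew in \<open>i\<close> and \<open>j\<close>.\<close>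

lemma sum_along_ddir_zero:
  assumes "C2 f"
  shows "(\<Sum>i\<in>I. along i (\<lambda>y. ddir f y (e i)) x) = 0"
proof -
  let ?H = "\<lambda>i j. ddir (\<lambda>y. ddir f y (e i)) x (e j)"
  let ?c = "\<lambda>i j. \<kappa> x (br (e i) (e j))"
  have "along i (\<lambda>y. ddir f y (e i)) x = (\<Sum>j\<in>I. 1 / 4 * (?c i j * ?H i j))" for i
    unfolding along_def
    using linear_expansion_real[OF linear_ddir[OF C1_differentiable[OF C2_imp_C1_ddir[OF assms]]],
        of "e i" x "br (e i) x"]
    by (simp add: killing_br_swap sum_distrib_left sum_negf)
  then have "(\<Sum>i\<in>I. along i (\<lambda>y. ddir f y (e i)) x) = (\<Sum>i\<in>I. \<Sum>j\<in>I. 1 / 4 * (?c i j * ?H i j))"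
    (is "?S = ?T") by simp
  moreover have "?T = (\<Sum>j\<in>I. \<Sum>i\<in>I. 1 / 4 * (?c i j * ?H i j))"
    by (rule sum.swap)
  moreover have skew: "1 / 4 * (?c i j * ?H i j) = - (1 / 4 * (?c j i * ?H j i))" for i j
    using br_skew[of "e i" "e j"] second_derivative_symmetric[OF assms, of "e i" x "e j"]
    by (simp add: killing.minus_right)
  \<comment> \<open>Applying skewness termwise after the exchange of sums, and renaming the indices,
    gives \<open>?T = - ?T\<close>.\<close>
  have "(\<Sum>j\<in>I. \<Sum>i\<in>I. 1 / 4 * (?c i j * ?H i j))
      = (\<Sum>j\<in>I. \<Sum>i\<in>I. - (1 / 4 * (?c j i * ?H j i)))"
    by (intro sum.cong refl skew)
  then have "(\<Sum>j\<in>I. \<Sum>i\<in>I. 1 / 4 * (?c i j * ?H i j)) = - ?T"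
    by (simp only: sum_negf)
  ultimately show ?thesis
    by simp
qed

text \<open>Invariance moves the bracket off the gradient of \<open>g\<close>: the Lie-Poisson
  bracket differentiates \<open>g\<close> along a field tangent to the orbit.\<close>

lemma lie_poisson_eq_ddir:
  assumes "g differentiable (at x)"
  shows "lie_poisson br f g x = ddir g x (br x (grad br f x))"
  unfolding lie_poisson_def killing_grad[OF assms, symmetric]
  by (metis killing_invariant killing_commute)

lemma lie_poisson_eq_sum:
  assumes "f differentiable (at x)" "g differentiable (at x)"
  shows "lie_poisson br f g x = 1 / 4 * (\<Sum>i\<in>I. ddir f x (e i) * along i g x)"
proof -
  have "ddir g x (br x (grad br f x)) = - ddir g x (br (grad br f x) x)"
    using br_skew[of x] linear_neg[OF linear_ddir[OF assms(2)]] by metis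
  then show ?thesis
    using ddir_br[OF assms(2)] assms(1) by (simp add: lie_poisson_eq_ddir assms(2) killing_grad)
qed

text \<open>This is the vanishing of the Lie-Poisson bracket of \<open>f\<close> with itself, in
  frame form.\<close>

lemma sum_ddir_along_self:
  assumes "f differentiable (at x)"
  shows "(\<Sum>i\<in>I. ddir f x (e i) * along i f x) = 0"
  using lie_poisson_eq_sum[OF assms assms] br_self by (simp add: lie_poisson_def killing.zero_right)

section \<open>Divergence of the drift and noise fields\<close>

lemma divergence_scaleR:
  assumes "f differentiable (at x)" "(F has_derivative F') (at x)"
  shows "divergence (\<lambda>y. f y *\<^sub>R F y) x = ddir f x (F x) + f x * trace_lin F'"
proof -
  have "((\<lambda>y. f y *\<^sub>R F y) has_derivative (\<lambda>v. f x *\<^sub>R F' v + ddir f x v *\<^sub>R F x)) (at x)"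
    by (intro has_derivative_scaleR has_derivative_ddir assms)
  then have "frechet_derivative (\<lambda>y. f y *\<^sub>R F y) (at x) = (\<lambda>v. f x *\<^sub>R F' v + ddir f x v *\<^sub>R F x)"
    using frechet_derivative_at by metis
  then show ?thesis
    by (simp add: divergence_def trace_lin_add trace_lin_scaleR trace_lin_rank_one
        linear_ddir[OF assms(1)])
qed

lemma has_derivative_br: "(br z has_derivative br z) (at x)"
  by (rule bounded_linear_imp_has_derivative[OF br.bounded_linear_right])

lemma divergence_scaleR_br:
  assumes "f differentiable (at x)"
  shows "divergence (\<lambda>y. f y *\<^sub>R br z y) x = ddir f x (br z x)"
  using divergence_scaleR[OF assms has_derivative_br] by (simp add: trace_br)

lemma divergence_frame:
  assumes "\<And>i. i \<in> I \<Longrightarrow> f i differentiable (at x)"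
  shows "divergence (\<lambda>y. \<Sum>i\<in>I. f i y *\<^sub>R br (e i) y) x = (\<Sum>i\<in>I. along i (f i) x)"
proof -
  have "(\<lambda>y. f i y *\<^sub>R br (e i) y) differentiable (at x)" if "i \<in> I" for i
    by (intro differentiable_scaleR assms[OF that]) (use has_derivative_br in \<open>auto simp: differentiable_def\<close>)
  then show ?thesis
    by (simp add: divergence_sum divergence_scaleR_br assms along_def)
qed

lemma differentiable_frame:
  assumes "\<And>i. i \<in> I \<Longrightarrow> f i differentiable (at x)"
  shows "(\<lambda>y. \<Sum>i\<in>I. f i y *\<^sub>R br (e i) y) differentiable (at x)"
proof -
  have "br (e i) differentiable (at x)" for i
    using has_derivative_br by (auto simp: differentiable_def)
  then show ?thesis
    using finite_I by (intro differentiable_sum differentiable_scaleR ballI assms) auto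
qed

lemma divergence_product_frame:
  assumes "f differentiable (at x)" "\<And>i. i \<in> I \<Longrightarrow> a i differentiable (at x)"
    "\<And>y. F y = (\<Sum>i\<in>I. a i y *\<^sub>R br (e i) y)"
  shows "divergence (\<lambda>y. f y *\<^sub>R F y) x = (\<Sum>i\<in>I. along i (\<lambda>y. f y * a i y) x)"
  using divergence_frame[of "\<lambda>i y. f y * a i y" x] assms
  by (simp add: scaleR_sum_right differentiable_mult)

lemma hamiltonian_field_frame:
  assumes "h differentiable (at x)"
  shows "br (grad br h x) x = (\<Sum>i\<in>I. (- 1 / 4 * ddir h x (e i)) *\<^sub>R br (e i) x)"
  using linear_expansion[OF linear_br_left, of "grad br h x" x] by (simp only: killing_grad[OF assms])

text \<open>A Liouville theorem: the field itself is divergence free by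
  \<open>sum_along_ddir_zero\<close>, so only the derivative of \<open>f\<close> along it
  remains.\<close>

lemma divergence_hamiltonian_field:
  assumes "C2 h" "f differentiable (at x)"
  shows "divergence (\<lambda>y. f y *\<^sub>R br (grad br h y) y) x = - lie_poisson br h f x"
proof -
  have d: "(\<lambda>y. ddir h y v) differentiable (at y)"
    "(\<lambda>y. - 1 / 4 * ddir h y v) differentiable (at y)" for v y
    by (intro C1_differentiable C1_cmult C2_imp_C1_ddir assms)+
  have "divergence (\<lambda>y. f y *\<^sub>R br (grad br h y) y) x
      = (\<Sum>i\<in>I. along i (\<lambda>y. f y * (- 1 / 4 * ddir h y (e i))) x)"
    by (intro divergence_product_frame hamiltonian_field_frame assms C2_differentiable[OF assms(1)]
        C1_differentiable C1_cmult C2_imp_C1_ddir)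
  also have "\<dots> = (\<Sum>i\<in>I. - 1 / 4 * f x * along i (\<lambda>y. ddir h y (e i)) x
      - 1 / 4 * (ddir h x (e i) * along i f x))"
    by (intro sum.cong refl, simp only: along_mult[OF assms(2) d(2)] along_cmult[OF d(1)]) simp
  also have "\<dots> = - lie_poisson br h f x"
    using sum_along_ddir_zero[OF assms(1), of x]
    by (simp only: sum_subtractf sum_distrib_left[symmetric]
        lie_poisson_eq_sum[OF C2_differentiable[OF assms(1)] assms(2)])
  finally show ?thesis .
qed

lemma dissipative_term_eq:
  "dissipative_term br h \<theta> (killing_casimir br) x = (4 * \<theta>) *\<^sub>R br x (br x (grad br h x))"
  by (simp add: dissipative_term_def grad_casimir br.scaleR_left br.scaleR_right)

text \<open>The 4 produced by the Casimir gradients is exactly the 4 in \<open>along_sq_sum\<close>,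
  so the normalisation of the frame leaves the coefficient \<open>\<theta>\<close> alone.\<close>

lemma dissipative_term_frame:
  assumes "h differentiable (at x)"
  shows "dissipative_term br h \<theta> (killing_casimir br) x = (\<Sum>i\<in>I. (\<theta> * along i h x) *\<^sub>R br (e i) x)"
proof -
  have "(4 * \<theta>) *\<^sub>R br x (br x (grad br h x)) = \<theta> *\<^sub>R 4 *\<^sub>R br x (br x (grad br h x))"
    by simp
  then show ?thesis
    by (simp only: dissipative_term_eq along_sq_sum[OF assms, symmetric] scaleR_sum_right scaleR_scaleR)
qed

text \<open>One divergence computed twice: the frame form combines with the diffusion into a flux,
  and the product-rule form matches the terms of \<open>fp_operator\<close>.\<close>

lemma divergence_dissipative_term:
  fixes \<theta> :: real
  assumes "C2 h" "f differentiable (at x)"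
  defines "D \<equiv> dissipative_term br h \<theta> (killing_casimir br)"
  shows "divergence (\<lambda>y. f y *\<^sub>R D y) x = (\<Sum>i\<in>I. along i (\<lambda>y. f y * (\<theta> * along i h y)) x)"
    and "divergence (\<lambda>y. f y *\<^sub>R D y) x = f x * divergence D x
      - \<theta> * killing br (br (grad br f x) (grad br (killing_casimir br) x))
              (br (grad br h x) (grad br (killing_casimir br) x))"
    and "D differentiable (at x)"
proof -
  have D: "D y = (\<Sum>i\<in>I. (\<theta> * along i h y) *\<^sub>R br (e i) y)" for y
    unfolding D_def by (rule dissipative_term_frame[OF C2_differentiable[OF assms(1)]])
  have d: "(\<lambda>y. \<theta> * along i h y) differentiable (at y)" for i y
    by (intro C1_differentiable C1_cmult C1_along assms)
  show "divergence (\<lambda>y. f y *\<^sub>R D y) x = (\<Sum>i\<in>I. along i (\<lambda>y. f y * (\<theta> * along i h y)) x)"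
    by (intro divergence_product_frame D d assms(2))
  show *: "D differentiable (at x)"
    using differentiable_frame[of "\<lambda>i y. \<theta> * along i h y", OF d] by (simp only: D[abs_def])
  \<comment> \<open>Invariance carries one bracket over to the gradient of \<open>f\<close>;
    reversing the order in the other bracket produces the minus sign.\<close>
  have "ddir f x (D x) = \<kappa> (grad br f x) (D x)"
    by (simp add: killing_grad assms(2))
  also have "\<dots> = - \<theta> * killing br (br (grad br f x) (grad br (killing_casimir br) x))
              (br (grad br h x) (grad br (killing_casimir br) x))"
    using br_skew[of "grad br h x" x]
    by (simp add: D_def dissipative_term_eq grad_casimir killing_invariant killing.scaleR_right
        br.scaleR_right br.scaleR_left br.minus_right killing.minus_right killing.scaleR_left)
  finally show "divergence (\<lambda>y. f y *\<^sub>R D y) x = f x * divergence D x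
      - \<theta> * killing br (br (grad br f x) (grad br (killing_casimir br) x))
              (br (grad br h x) (grad br (killing_casimir br) x))"
    using divergence_scaleR[OF assms(2) *[unfolded frechet_derivative_works]]
    by (simp add: divergence_def)
qed

text \<open>Bracketing with a noise potential is, up to the factor \<open>\<sigma>\<close>, the
  derivation along a frame field; the two minus signs cancel.\<close>

lemma lie_poisson_linear_potential:
  assumes "g differentiable (at x)" "grad br \<phi> x = - (\<sigma> *\<^sub>R e i)"
  shows "lie_poisson br \<phi> g x = \<sigma> * along i g x"
proof -
  have "br x (grad br \<phi> x) = \<sigma> *\<^sub>R br (e i) x"
    using br_skew[of x "e i"] by (simp add: assms(2) br.minus_right br.scaleR_right)
  then show ?thesis
    by (simp add: lie_poisson_eq_ddir assms(1) along_def linear_cmul[OF linear_ddir])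
qed

lemma lie_poisson_linear_potential_twice:
  assumes "C2 f" "\<And>x. grad br \<phi> x = - (\<sigma> *\<^sub>R e i)"
  shows "lie_poisson br \<phi> (lie_poisson br \<phi> f) x = \<sigma>\<^sup>2 * along i (along i f) x"
proof -
  have "lie_poisson br \<phi> f = (\<lambda>x. \<sigma> * along i f x)"
    by (intro ext lie_poisson_linear_potential C2_differentiable assms)
  moreover have "C1 (\<lambda>x. \<sigma> * along i f x)" "C1 (along i f)"
    by (intro C1_cmult C1_along assms)+
  ultimately show ?thesis
    by (simp add: lie_poisson_linear_potential[OF C1_differentiable assms(2)] along_cmult
        C1_differentiable power2_eq_square)
qed

text \<open>Noise fields are divergence free, so the forward operator of the noise is the same
  second-order operator as the double Lie-Poisson bracket.\<close>

lemma divergence_noise_twice: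
  assumes "C2 f"
  shows "divergence (\<lambda>y. divergence (\<lambda>z. f z *\<^sub>R br (\<sigma> *\<^sub>R e i) z) y *\<^sub>R br (\<sigma> *\<^sub>R e i) y) x
    = \<sigma>\<^sup>2 * along i (along i f) x"
proof -
  have "divergence (\<lambda>z. g z *\<^sub>R br (\<sigma> *\<^sub>R e i) z) y = \<sigma> * along i g y"
    if "g differentiable (at y)" for g y
    using divergence_scaleR_br[OF that, of "\<sigma> *\<^sub>R e i"] linear_cmul[OF linear_ddir[OF that]]
    by (simp add: br.scaleR_left along_def)
  moreover have "C1 (\<lambda>x. \<sigma> * along i f x)" "C1 (along i f)"
    by (intro C1_cmult C1_along assms)+
  ultimately show ?thesis
    by (simp add: C2_differentiable[OF assms] along_cmult C1_differentiable power2_eq_square)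
qed

end

section \<open>The Fokker-Planck operator in a Killing frame\<close>

locale dissipative_system = killing_frame br e "{1..DIM('g)}"
  for br :: "'g::euclidean_space \<Rightarrow> 'g \<Rightarrow> 'g" and e :: "nat \<Rightarrow> 'g" +
  fixes h :: "'g \<Rightarrow> real" and \<theta> \<sigma> :: real and \<Phi> :: "nat \<Rightarrow> 'g \<Rightarrow> real"
  assumes C2_h: "C2 h" and sigma_nz: "\<sigma> \<noteq> 0"
    and grad_potential: "\<And>i x. i \<in> {1..DIM('g)} \<Longrightarrow> grad br (\<Phi> i) x = - (\<sigma> *\<^sub>R e i)"
begin

abbreviation fp :: "('g \<Rightarrow> real) \<Rightarrow> 'g \<Rightarrow> real" where
  "fp \<equiv> fp_operator br h \<theta> (killing_casimir br) \<Phi>"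

lemma h_differentiable: "h differentiable (at x)"
  by (rule C2_differentiable[OF C2_h])

text \<open>The two dissipative terms of the operator fold into a single divergence.\<close>

lemma fp_eq:
  assumes "C2 P"
  shows "fp P x = lie_poisson br h P x
    - divergence (\<lambda>y. P y *\<^sub>R dissipative_term br h \<theta> (killing_casimir br) y) x
    - 1 / 2 * (\<Sum>i\<in>{1..DIM('g)}. \<sigma>\<^sup>2 * along i (along i P) x)"
proof -
  have "(\<Sum>i\<in>{1..DIM('g)}. lie_poisson br (\<Phi> i) (lie_poisson br (\<Phi> i) P) x)
      = (\<Sum>i\<in>{1..DIM('g)}. \<sigma>\<^sup>2 * along i (along i P) x)"
    by (intro sum.cong refl lie_poisson_linear_potential_twice assms grad_potential)
  then show ?thesis
    unfolding fp_operator_def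
      divergence_dissipative_term(2)[OF C2_h C2_differentiable[OF assms]] by simp
qed

text \<open>The two sides are matched term by term: Hamiltonian drift with Lie-Poisson bracket,
  dissipation with divergence, noise with double brackets.\<close>

lemma stratonovich_fokker_planck_eq:
  assumes "C2 P" "\<And>i. i \<in> {1..DIM('g)} \<Longrightarrow> s i = \<sigma> *\<^sub>R e i"
  shows "stratonovich_fokker_planck (sep_drift br h \<theta> (killing_casimir br)) (sep_noise br s)
    DIM('g) P x = - fp P x"
proof -
  let ?D = "dissipative_term br h \<theta> (killing_casimir br)"
  let ?H = "\<lambda>y. br (grad br h y) y"
  have P: "P differentiable (at x)"
    by (rule C2_differentiable[OF assms(1)])
  have noise: "(\<Sum>i\<in>{1..DIM('g)}. divergence (\<lambda>y. divergence (\<lambda>z. P z *\<^sub>R sep_noise br s i z) y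
      *\<^sub>R sep_noise br s i y) x) = (\<Sum>i\<in>{1..DIM('g)}. \<sigma>\<^sup>2 * along i (along i P) x)"
    unfolding sep_noise_def
    by (intro sum.cong refl) (simp only: assms(2) divergence_noise_twice[OF assms(1)])
  have "(\<lambda>y. (- 1 / 4 * ddir h y (e i))) differentiable (at x)" for i
    by (intro C1_differentiable C1_cmult C2_imp_C1_ddir C2_h)
  then have "?H differentiable (at x)"
    using differentiable_frame[of "\<lambda>i y. - 1 / 4 * ddir h y (e i)" x]
    by (simp only: hamiltonian_field_frame[OF h_differentiable, abs_def])
  then have "(\<lambda>y. P y *\<^sub>R ?H y) differentiable (at x)" "(\<lambda>y. P y *\<^sub>R ?D y) differentiable (at x)"
    by (intro differentiable_scaleR P divergence_dissipative_term(3)[OF C2_h P] | assumption)+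
  then have "divergence (\<lambda>y. P y *\<^sub>R ?H y + P y *\<^sub>R ?D y) x
      = divergence (\<lambda>y. P y *\<^sub>R ?H y) x + divergence (\<lambda>y. P y *\<^sub>R ?D y) x"
    by (rule divergence_add)
  then show ?thesis
    unfolding stratonovich_fokker_planck_def noise fp_eq[OF assms(1)]
    by (simp add: sep_drift_def scaleR_add_right divergence_hamiltonian_field[OF C2_h P])
qed

abbreviation gibbs :: "'g \<Rightarrow> real" where
  "gibbs \<equiv> \<lambda>x. exp (- (2 * \<theta> / \<sigma>\<^sup>2) * h x)"

lemma C2_gibbs: "C2 gibbs"
  by (rule C2_exp_scaled[OF C2_h])

lemma along_gibbs: "along i gibbs x = - (2 * \<theta> / \<sigma>\<^sup>2) * gibbs x * along i h x"
  using ddir_exp_scaled(2)[OF h_differentiable, of "- (2 * \<theta> / \<sigma>\<^sup>2)" x "br (e i) x"]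
  by (simp add: along_def)

text \<open>For \<open>u = 1\<close> the drift and diffusion parts of the flux cancel.\<close>

lemma flux_gibbs_mult:
  assumes "u differentiable (at x)"
  shows "gibbs x * u x * (\<theta> * along i h x) + \<sigma>\<^sup>2 / 2 * along i (\<lambda>y. gibbs y * u y) x
    = \<sigma>\<^sup>2 / 2 * (gibbs x * along i u x)"
  unfolding along_mult[OF C2_differentiable[OF C2_gibbs] assms] along_gibbs
  using sigma_nz by (simp add: field_simps)

text \<open>Differentiating the flux identity \<open>flux_gibbs_mult\<close> along the frame handles
  dissipation and noise together; the Hamiltonian bracket passes through the Gibbs factor.\<close>

lemma fp_gibbs_mult:
  assumes "C2 u"
  shows "fp (\<lambda>y. gibbs y * u y) x = 1 / 4 * (gibbs x * (\<Sum>i\<in>{1..DIM('g)}. ddir h x (e i) * along i u x))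
    - \<sigma>\<^sup>2 / 2 * (\<Sum>i\<in>{1..DIM('g)}. along i (\<lambda>y. gibbs y * along i u y) x)"
proof -
  let ?P = "\<lambda>y. gibbs y * u y"
  have P: "C2 ?P"
    by (intro C2_mult C2_gibbs assms)
  have du: "u differentiable (at y)" and dg: "gibbs differentiable (at y)"
    and dP: "?P differentiable (at y)" for y
    by (intro C2_differentiable assms C2_gibbs P)+
  have C1: "C1 (\<lambda>y. ?P y * (\<theta> * along i h y))" "C1 (along i ?P)" "C1 (\<lambda>y. gibbs y * along i u y)"
    "C1 (\<lambda>y. \<sigma>\<^sup>2 / 2 * along i ?P y)" for i
    by (intro C1_mult C1_const C1_along C2_imp_C1 C2_gibbs P C2_h assms)+
  have flux: "along i (\<lambda>y. ?P y * (\<theta> * along i h y)) x + \<sigma>\<^sup>2 / 2 * along i (along i ?P) x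
      = \<sigma>\<^sup>2 / 2 * along i (\<lambda>y. gibbs y * along i u y) x" for i
  proof -
    have "along i (\<lambda>y. ?P y * (\<theta> * along i h y)) x + \<sigma>\<^sup>2 / 2 * along i (along i ?P) x
        = along i (\<lambda>y. ?P y * (\<theta> * along i h y) + \<sigma>\<^sup>2 / 2 * along i ?P y) x"
      by (simp only: along_add[OF C1_differentiable[OF C1(1)] C1_differentiable[OF C1(4)]]
          along_cmult[OF C1_differentiable[OF C1(2)]])
    then show ?thesis
      by (simp only: flux_gibbs_mult[OF du] along_cmult[OF C1_differentiable[OF C1(3)]])
  qed
  have "lie_poisson br h ?P x = 1 / 4 * (\<Sum>i\<in>{1..DIM('g)}. gibbs x * (ddir h x (e i) * along i u x)
      - 2 * \<theta> / \<sigma>\<^sup>2 * gibbs x * u x * (ddir h x (e i) * along i h x))"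
    unfolding lie_poisson_eq_sum[OF h_differentiable dP] along_mult[OF dg du] along_gibbs
    by (intro arg_cong[where f = "\<lambda>t. 1 / 4 * t"] sum.cong refl) (simp add: algebra_simps)
  \<comment> \<open>The derivative of the Gibbs factor is a multiple of that of \<open>h\<close>, so
    its contribution is a multiple of the bracket of \<open>h\<close> with itself.\<close>
  also have "\<dots> = 1 / 4 * (gibbs x * (\<Sum>i\<in>{1..DIM('g)}. ddir h x (e i) * along i u x))"
    by (simp only: sum_subtractf sum_distrib_left[symmetric] sum_ddir_along_self[OF h_differentiable])
      simp
  finally have lp: "lie_poisson br h ?P x
      = 1 / 4 * (gibbs x * (\<Sum>i\<in>{1..DIM('g)}. ddir h x (e i) * along i u x))" .
  have "(\<Sum>i\<in>{1..DIM('g)}. along i (\<lambda>y. ?P y * (\<theta> * along i h y)) x)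
      + 1 / 2 * (\<Sum>i\<in>{1..DIM('g)}. \<sigma>\<^sup>2 * along i (along i ?P) x)
      = (\<Sum>i\<in>{1..DIM('g)}. along i (\<lambda>y. ?P y * (\<theta> * along i h y)) x + \<sigma>\<^sup>2 / 2 * along i (along i ?P) x)"
    by (simp add: sum.distrib sum_distrib_left)
  also have "\<dots> = \<sigma>\<^sup>2 / 2 * (\<Sum>i\<in>{1..DIM('g)}. along i (\<lambda>y. gibbs y * along i u y) x)"
    by (simp only: flux sum_distrib_left)
  finally show ?thesis
    unfolding fp_eq[OF P] divergence_dissipative_term(1)[OF C2_h dP] lp by linarith
qed

lemma fp_gibbs: "fp (\<lambda>y. gibbs y * c) x = 0"
  unfolding fp_gibbs_mult[OF C2_const] by (simp add: along_def)

text \<open>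
  The drift by \<open>h\<close> is a divergence after multiplication by \<open>u\<close>, so only the dissipation
  of \<open>u\<^sup>2\<close> survives integration over an orbit.
\<close>

lemma energy_identity:
  assumes "C2 u"
  defines "W \<equiv> \<lambda>i y. 1 / 8 * (ddir h y (e i) * (gibbs y * (u y * u y)))
    + (- \<sigma>\<^sup>2 / 2) * (u y * (gibbs y * along i u y))"
  shows "u x * fp (\<lambda>y. gibbs y * u y) x
    = (\<Sum>i\<in>{1..DIM('g)}. along i (W i) x) + \<sigma>\<^sup>2 / 2 * (\<Sum>i\<in>{1..DIM('g)}. gibbs x * (along i u x)\<^sup>2)"
    and "C1 (W i)"
proof -
  have C1: "C1 (\<lambda>y. ddir h y v)" "C1 u" "C1 gibbs" "C1 (along i u)"
    "C1 (\<lambda>y. gibbs y * along i u y)" "C1 (\<lambda>y. u y * (gibbs y * along i u y))"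
    "C1 (\<lambda>y. gibbs y * (u y * u y))" "C1 (\<lambda>y. u y * u y)"
    "C1 (\<lambda>y. ddir h y v * (gibbs y * (u y * u y)))" for v i
    by (intro C1_mult C1_along C2_imp_C1_ddir C2_imp_C1 C2_gibbs C2_h assms)+
  show "C1 (W i)"
    unfolding W_def by (intro C1_add C1_cmult C1)
  note d = C1[THEN C1_differentiable]
  let ?a = "\<lambda>i. ddir h x (e i)"
  \<comment> \<open>The weight \<open>1 / 8\<close> is half of the \<open>1 / 4\<close> in the drift
    term, because differentiating \<open>u y * u y\<close> yields a factor 2. The second part of
    \<open>W\<close> integrates the diffusion term by parts.\<close>
  have "along i (W i) x = 1 / 8 * (gibbs x * (u x)\<^sup>2) * along i (\<lambda>y. ddir h y (e i)) x
      - 1 / 8 * (2 * \<theta> / \<sigma>\<^sup>2 * gibbs x * (u x)\<^sup>2) * (?a i * along i h x)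
      + 1 / 4 * (gibbs x * u x) * (?a i * along i u x)
      - \<sigma>\<^sup>2 / 2 * u x * along i (\<lambda>y. gibbs y * along i u y) x
      - \<sigma>\<^sup>2 / 2 * (gibbs x * (along i u x)\<^sup>2)" for i
  proof -
    have "along i (W i) x = 1 / 8 * (?a i * (gibbs x * (u x * along i u x + along i u x * u x)
          + along i gibbs x * (u x * u x)) + along i (\<lambda>y. ddir h y (e i)) x * (gibbs x * (u x * u x)))
        + (- \<sigma>\<^sup>2 / 2) * (u x * along i (\<lambda>y. gibbs y * along i u y) x
          + along i u x * (gibbs x * along i u x))"
      unfolding W_def
      by (simp only: along_add along_mult along_const d differentiable_const differentiable_mult)
    then show ?thesis
      unfolding along_gibbs by (simp add: algebra_simps power2_eq_square)
  qed
  \<comment> \<open>On summation the first two terms drop out: one by symmetry of the Hessian, the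
    other as the bracket of \<open>h\<close> with itself.\<close>
  then have "(\<Sum>i\<in>{1..DIM('g)}. along i (W i) x)
      = 1 / 4 * (gibbs x * u x) * (\<Sum>i\<in>{1..DIM('g)}. ?a i * along i u x)
      - \<sigma>\<^sup>2 / 2 * u x * (\<Sum>i\<in>{1..DIM('g)}. along i (\<lambda>y. gibbs y * along i u y) x)
      - \<sigma>\<^sup>2 / 2 * (\<Sum>i\<in>{1..DIM('g)}. gibbs x * (along i u x)\<^sup>2)"
    by (simp only: sum_subtractf sum.distrib sum_distrib_left[symmetric] sum_along_ddir_zero[OF C2_h]
        sum_ddir_along_self[OF h_differentiable])
  then show "u x * fp (\<lambda>y. gibbs y * u y) x
    = (\<Sum>i\<in>{1..DIM('g)}. along i (W i) x) + \<sigma>\<^sup>2 / 2 * (\<Sum>i\<in>{1..DIM('g)}. gibbs x * (along i u x)\<^sup>2)"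
    unfolding fp_gibbs_mult[OF assms(1)] by (simp add: algebra_simps)
qed

end

section \<open>Flows of the adjoint action\<close>

context killing_frame
begin

lemma funpow_br_scaleR: "(br (t *\<^sub>R \<xi>) ^^ k) \<mu> = t ^ k *\<^sub>R (br \<xi> ^^ k) \<mu>"
  by (induction k) (simp_all add: br.scaleR_left br.scaleR_right mult.commute)

text \<open>The operator \<open>br \<xi>\<close> is bounded, so an exponential series dominates;
  hence the infinite sum in \<open>exp_ad\<close> is a genuine limit.\<close>

lemma exp_ad_sums: "(\<lambda>k. (1 / fact k) *\<^sub>R (br \<xi> ^^ k) \<mu>) sums exp_ad br \<xi> \<mu>"
proof -
  obtain K where K: "0 \<le> K" "\<And>y. norm (br \<xi> y) \<le> norm y * K"
    using bounded_linear.nonneg_bounded[OF br.bounded_linear_right] by blast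
  have pow: "norm ((br \<xi> ^^ k) \<mu>) \<le> K ^ k * norm \<mu>" for k
  proof (induction k)
    case (Suc k)
    have "norm ((br \<xi> ^^ Suc k) \<mu>) \<le> norm ((br \<xi> ^^ k) \<mu>) * K"
      using K(2) by simp
    also have "\<dots> \<le> K ^ k * norm \<mu> * K"
      by (intro mult_right_mono Suc K)
    finally show ?case
      by (simp add: mult_ac)
  qed simp
  have "summable (\<lambda>k. inverse (fact k) * K ^ k * norm \<mu>)"
    by (intro summable_mult2 summable_exp)
  then have "summable (\<lambda>k. (1 / fact k) *\<^sub>R (br \<xi> ^^ k) \<mu>)"
    by (rule summable_comparison_test'[where N = 0])
      (use pow in \<open>auto simp: field_simps divide_right_mono\<close>)
  then show ?thesis
    unfolding exp_ad_def by (rule summable_sums)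
qed

lemma linear_exp_ad: "linear (exp_ad br \<xi>)"
proof (rule linearI)
  have pow: "linear (br \<xi> ^^ k)" for k
    by (induction k) (auto intro: linear_compose[OF _ linear_br_right] simp: linear_id[unfolded id_def] simp del: o_apply)
  show "exp_ad br \<xi> (x + y) = exp_ad br \<xi> x + exp_ad br \<xi> y" for x y
    using sums_add[OF exp_ad_sums[of \<xi> x] exp_ad_sums[of \<xi> y]] exp_ad_sums[of \<xi> "x + y"]
    by (simp add: linear_add[OF pow] scaleR_add_right sums_unique2)
  show "exp_ad br \<xi> (c *\<^sub>R x) = c *\<^sub>R exp_ad br \<xi> x" for c x
    using sums_scaleR_right[OF exp_ad_sums[of \<xi> x], of c] exp_ad_sums[of \<xi> "c *\<^sub>R x"]
    by (simp add: linear_cmul[OF pow] mult.commute sums_unique2)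
qed

lemma continuous_on_exp_ad: "continuous_on S (exp_ad br \<xi>)"
  by (rule linear_continuous_on) (simp add: linear_exp_ad linear_conv_bounded_linear[symmetric])

lemma exp_ad_measurable: "exp_ad br \<xi> \<in> borel \<rightarrow>\<^sub>M borel"
  by (rule borel_measurable_continuous_onI[OF continuous_on_exp_ad])

lemma exp_ad_zero: "exp_ad br 0 \<mu> = \<mu>"
proof -
  have "(1 / fact k) *\<^sub>R (br 0 ^^ k) \<mu> = (if k = 0 then \<mu> else 0)" for k
    by (cases k) (simp_all add: br.zero_left)
  then have "(\<lambda>k. if k = 0 then \<mu> else 0) sums exp_ad br 0 \<mu>"
    using exp_ad_sums[of 0 \<mu>] by (simp only:)
  then show ?thesis
    using sums_single[of 0 "\<lambda>_. \<mu>"] sums_unique2 by blast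
qed

text \<open>Each coordinate is an everywhere convergent power series in \<open>t\<close>, which may
  be differentiated term by term.\<close>

lemma exp_ad_flow:
  "((\<lambda>t. exp_ad br (t *\<^sub>R \<xi>) \<mu>) has_vector_derivative br \<xi> (exp_ad br (t *\<^sub>R \<xi>) \<mu>)) (at t)"
proof -
  let ?E = "\<lambda>t. exp_ad br (t *\<^sub>R \<xi>) \<mu>"
  have series: "(\<lambda>k. L ((br \<xi> ^^ k) \<mu>) / fact k * t ^ k) sums L (?E t)"
    if "bounded_linear L" for L :: "'g \<Rightarrow> real" and t
    using bounded_linear.sums[OF that exp_ad_sums[of "t *\<^sub>R \<xi>" \<mu>]]
    by (simp add: funpow_br_scaleR linear_cmul[OF bounded_linear.linear[OF that]] field_simps)
  have "((\<lambda>t. ?E t \<bullet> b) has_real_derivative br \<xi> (?E t) \<bullet> b) (at t)" for b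
  proof -
    define c where "c k = ((br \<xi> ^^ k) \<mu> \<bullet> b) / fact k" for k
    have c: "(\<lambda>k. c k * t ^ k) sums (?E t \<bullet> b)" for t
      unfolding c_def by (rule series) (rule bounded_linear_inner_left)
    \<comment> \<open>Differentiation shifts the coefficients by one place, which amounts to one
      further application of \<open>br \<xi>\<close>.\<close>
    have "diffs c k * t ^ k = (br \<xi> ((br \<xi> ^^ k) \<mu>) \<bullet> b) / fact k * t ^ k" for k
      by (simp add: diffs_def c_def field_simps del: of_nat_Suc)
    moreover have "(\<lambda>k. (br \<xi> ((br \<xi> ^^ k) \<mu>) \<bullet> b) / fact k * t ^ k) sums (br \<xi> (?E t) \<bullet> b)"
      by (rule series[where L = "\<lambda>y. br \<xi> y \<bullet> b"])
        (rule bounded_linear_compose[OF bounded_linear_inner_left br.bounded_linear_right])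
    ultimately have "(\<Sum>k. diffs c k * t ^ k) = br \<xi> (?E t) \<bullet> b"
      by (simp add: sums_iff)
    moreover have "((\<lambda>t. \<Sum>k. c k * t ^ k) has_real_derivative (\<Sum>k. diffs c k * t ^ k)) (at t)"
      by (rule termdiffs_strong_converges_everywhere) (use c sums_summable in blast)
    moreover have "(\<lambda>t. \<Sum>k. c k * t ^ k) = (\<lambda>t. ?E t \<bullet> b)"
      using c by (auto simp: sums_iff)
    ultimately show ?thesis
      by simp
  qed
  then have "((\<lambda>t. \<Sum>b\<in>Basis. (?E t \<bullet> b) *\<^sub>R b) has_vector_derivative
      (\<Sum>b\<in>Basis. (br \<xi> (?E t) \<bullet> b) *\<^sub>R b)) (at t)"
    by (intro has_vector_derivative_sum)
      (auto intro!: derivative_eq_intros)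
  then show ?thesis
    by (simp add: euclidean_representation)
qed

text \<open>The operator \<open>br \<xi>\<close> is skew for the Killing form, so the two terms of
  the product rule cancel.\<close>

lemma flow_killing_constant:
  assumes "\<And>t. (\<gamma> has_vector_derivative br \<xi> (\<gamma> t)) (at t)"
  shows "\<kappa> (\<gamma> t) (\<gamma> t) = \<kappa> (\<gamma> s) (\<gamma> s)"
proof -
  have "((\<lambda>t. \<kappa> (\<gamma> t) (\<gamma> t)) has_real_derivative 0) (at t)" for t
    using killing.has_vector_derivative[OF assms assms, of t]
    by (simp add: has_real_derivative_iff_has_vector_derivative killing_br_swap)
  then show ?thesis
    using DERIV_isconst_all[of "\<lambda>t. \<kappa> (\<gamma> t) (\<gamma> t)"] by blast
qed

text \<open>The Killing form is definite here, and constant along the difference of two flows.\<close>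

lemma flow_unique:
  assumes "\<And>t. (\<gamma> has_vector_derivative br \<xi> (\<gamma> t)) (at t)"
    and "\<And>t. (\<delta> has_vector_derivative br \<xi> (\<delta> t)) (at t)"
    and "\<gamma> s = \<delta> s"
  shows "\<gamma> t = \<delta> t"
proof -
  have "((\<lambda>t. \<gamma> t - \<delta> t) has_vector_derivative br \<xi> (\<gamma> t - \<delta> t)) (at t)" for t
    using has_vector_derivative_diff[OF assms(1,2), of t] by (simp add: br.diff_right)
  from flow_killing_constant[OF this, of t s] have "\<kappa> (\<gamma> t - \<delta> t) (\<gamma> t - \<delta> t) = 0"
    by (simp add: assms(3) killing.zero_left)
  then show ?thesis
    using killing_zero_imp by fastforce
qed

text \<open>Running the flow of \<open>\<xi>\<close> backwards from time 1 gives a flow of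
  \<open>- \<xi>\<close>. Uniqueness of flows replaces multiplying the two series.\<close>

lemma exp_ad_minus: "exp_ad br (- \<xi>) (exp_ad br \<xi> \<mu>) = \<mu>"
proof -
  have "((\<lambda>t. exp_ad br ((1 - t) *\<^sub>R \<xi>) \<mu>) has_vector_derivative
      br (- \<xi>) (exp_ad br ((1 - t) *\<^sub>R \<xi>) \<mu>)) (at t)" for t
  proof -
    have "((\<lambda>t. 1 - t) has_vector_derivative - 1) (at t)"
      by (auto intro!: derivative_eq_intros)
    from vector_diff_chain_at[OF this exp_ad_flow] show ?thesis
      by (simp add: o_def br.minus_left)
  qed
  from flow_unique[OF exp_ad_flow[of "- \<xi>" "exp_ad br \<xi> \<mu>"] this, of 0 1] show ?thesis
    by (simp add: exp_ad_zero)
qed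

lemma killing_exp_ad: "\<kappa> (exp_ad br \<xi> \<mu>) (exp_ad br \<xi> \<mu>) = \<kappa> \<mu> \<mu>"
  using flow_killing_constant[OF exp_ad_flow, of 1 \<xi> \<mu> 0] by (simp add: exp_ad_zero)

section \<open>Integration over an orbit\<close>

lemma orbit_subset_sphere: "coadjoint_orbit br \<mu> \<subseteq> {x. \<kappa> x x = \<kappa> \<mu> \<mu>}"
proof
  fix x assume "x \<in> coadjoint_orbit br \<mu>"
  then show "x \<in> {x. \<kappa> x x = \<kappa> \<mu> \<mu>}"
    by induction (simp_all add: killing_exp_ad)
qed

text \<open>Each generating step of the orbit is the end of a flow curve inside the orbit, along
  which the derivative of \<open>u\<close> is a combination of the vanishing
  \<open>along i u\<close>.\<close>

lemma constant_on_orbit: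
  assumes u: "C1 u" and zero: "\<And>i x. i \<in> I \<Longrightarrow> x \<in> coadjoint_orbit br \<mu> \<Longrightarrow> along i u x = 0"
    and "x \<in> coadjoint_orbit br \<mu>"
  shows "u x = u \<mu>"
  using assms(3)
proof induction
  case (step x \<xi>)
  have "((\<lambda>t. u (exp_ad br (t *\<^sub>R \<xi>) x)) has_real_derivative 0) (at t)" for t
  proof -
    have "exp_ad br (t *\<^sub>R \<xi>) x \<in> coadjoint_orbit br \<mu>"
      by (intro coadjoint_orbit.step step)
    then have "ddir u (exp_ad br (t *\<^sub>R \<xi>) x) (br \<xi> (exp_ad br (t *\<^sub>R \<xi>) x)) = 0"
      by (simp add: ddir_br C1_differentiable[OF u] zero)
    then show ?thesis
      using has_real_derivative_along[OF C1_differentiable[OF u] exp_ad_flow, of \<xi> x t] by simp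
  qed
  then have "u (exp_ad br (1 *\<^sub>R \<xi>) x) = u (exp_ad br (0 *\<^sub>R \<xi>) x)"
    using DERIV_isconst_all[of "\<lambda>t. u (exp_ad br (t *\<^sub>R \<xi>) x)"] by blast
  then show ?case
    using step.IH by (simp add: exp_ad_zero)
qed simp

end

locale orbit_integration = killing_frame br e I
  for br :: "'g::euclidean_space \<Rightarrow> 'g \<Rightarrow> 'g" and e :: "'i \<Rightarrow> 'g" and I +
  fixes \<mu>\<^sub>0 :: 'g and m :: "'g measure"
  assumes orbit_measure: "orbit_measure br (coadjoint_orbit br \<mu>\<^sub>0) m"
begin

lemma sets_m [measurable_cong]: "sets m = sets borel"
  using orbit_measure by (simp add: orbit_measure_def)

lemma space_m: "space m = UNIV"
  using sets_eq_imp_space_eq[OF sets_m] by simp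

lemma AE_orbit: "AE x in m. x \<in> coadjoint_orbit br \<mu>\<^sub>0"
  using orbit_measure by (simp add: orbit_measure_def)

lemma emeasure_UNIV: "emeasure m UNIV \<noteq> 0"
  using orbit_measure space_m by (simp add: orbit_measure_def)

lemma distr_exp_ad: "distr m borel (exp_ad br \<xi>) = m"
  using orbit_measure by (simp add: orbit_measure_def)

lemma exp_ad_measurable_m: "exp_ad br \<xi> \<in> m \<rightarrow>\<^sub>M borel"
  using exp_ad_measurable measurable_cong_sets[OF sets_m refl] by blast

text \<open>A compact set of full measure containing the orbit. It serves where compactness or
  measurability is wanted, neither being established for the orbit itself.\<close>

definition sphere :: "'g set" where "sphere = {x. \<kappa> x x = \<kappa> \<mu>\<^sub>0 \<mu>\<^sub>0}"

lemma compact_sphere: "compact sphere"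
  unfolding sphere_def by (rule compact_killing_sphere)

lemma AE_sphere: "AE x in m. x \<in> sphere"
  using AE_orbit by eventually_elim (use orbit_subset_sphere in \<open>auto simp: sphere_def\<close>)

lemma exp_ad_sphere: "x \<in> sphere \<Longrightarrow> exp_ad br \<xi> x \<in> sphere"
  by (simp add: sphere_def killing_exp_ad)

lemma finite_measure_m: "finite_measure m"
proof
  have "emeasure m (space m) = emeasure m sphere"
    using AE_sphere compact_imp_closed[OF compact_sphere]
    by (intro emeasure_eq_AE) (auto simp: sets_m space_m)
  also have "\<dots> < \<infinity>"
    using orbit_measure compact_sphere by (simp add: orbit_measure_def)
  finally show "emeasure m (space m) \<noteq> \<infinity>"
    by simp
qed

lemma continuous_measurable_m:
  fixes f :: "'g \<Rightarrow> real"
  shows "continuous_on UNIV f \<Longrightarrow> f \<in> borel_measurable m"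
  using borel_measurable_continuous_onI measurable_cong_sets[OF sets_m refl] by blast

lemma continuous_bounded_sphere:
  fixes f :: "'g \<Rightarrow> real"
  assumes "continuous_on UNIV f"
  obtains B where "\<And>x. x \<in> sphere \<Longrightarrow> \<bar>f x\<bar> \<le> B"
proof -
  have "bounded (f ` sphere)"
    by (intro compact_imp_bounded compact_continuous_image compact_sphere
        continuous_on_subset[OF assms]) simp
  then show thesis
    using that by (auto simp: bounded_iff)
qed

lemma integrable_continuous:
  fixes f :: "'g \<Rightarrow> real"
  assumes "continuous_on UNIV f"
  shows "integrable m f"
proof -
  obtain B where B: "\<And>x. x \<in> sphere \<Longrightarrow> \<bar>f x\<bar> \<le> B"
    using continuous_bounded_sphere[OF assms] by blast
  have "AE x in m. norm (f x) \<le> B"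
    using AE_sphere by eventually_elim (simp add: B)
  then show ?thesis
    by (rule finite_measure.integrable_const_bound[OF finite_measure_m _ continuous_measurable_m[OF assms]])
qed

lemma integral_exp_ad:
  fixes f :: "'g \<Rightarrow> real"
  assumes "continuous_on UNIV f"
  shows "(\<integral>x. f (exp_ad br \<xi> x) \<partial>m) = (\<integral>x. f x \<partial>m)"
  using integral_distr[OF exp_ad_measurable_m borel_measurable_continuous_onI[OF assms], of \<xi>]
  by (simp add: distr_exp_ad)

text \<open>Differentiate the invariance \<open>\<integral> f (exp (t ad \<xi>) x) = \<integral> f x\<close> at \<open>t = 0\<close>.\<close>

lemma integral_along:
  assumes f: "C1 f"
  shows "(\<integral>x. along i f x \<partial>m) = 0"
proof -
  define t where "t = (\<lambda>n. 1 / real (Suc n))"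
  have t: "0 < t n" for n by (simp add: t_def)
  have t0: "t \<longlonglongrightarrow> 0"
    unfolding t_def using LIMSEQ_inverse_real_of_nat by (simp add: inverse_eq_divide)
  define q where "q n x = (f (exp_ad br (t n *\<^sub>R e i) x) - f x) / t n" for n x
  have cont: "continuous_on UNIV f"
    by (rule C1_continuous[OF f])
  have cont_exp: "continuous_on UNIV (\<lambda>x. f (exp_ad br \<xi> x))" for \<xi>
    by (rule continuous_on_compose2[OF cont continuous_on_exp_ad]) simp
  have deriv: "((\<lambda>s. f (exp_ad br (s *\<^sub>R e i) x)) has_real_derivative
      along i f (exp_ad br (s *\<^sub>R e i) x)) (at s)" for s x
    unfolding along_def by (rule has_real_derivative_along[OF C1_differentiable[OF f] exp_ad_flow])
  obtain B where B: "\<And>x. x \<in> sphere \<Longrightarrow> \<bar>along i f x\<bar> \<le> B"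
    using continuous_bounded_sphere[OF continuous_along[OF f]] by blast
  have "(\<lambda>n. \<integral>x. q n x \<partial>m) \<longlonglongrightarrow> (\<integral>x. along i f x \<partial>m)"
  proof (rule integral_dominated_convergence[where w = "\<lambda>_. B"])
    show "along i f \<in> borel_measurable m"
      by (intro continuous_measurable_m continuous_along f)
    show "q n \<in> borel_measurable m" for n
      unfolding q_def using t[of n]
      by (intro continuous_measurable_m continuous_intros cont cont_exp) auto
    show "integrable m (\<lambda>_. B)"
      by (intro integrable_continuous continuous_on_const)
    show "AE x in m. (\<lambda>n. q n x) \<longlonglongrightarrow> along i f x"
    proof (rule AE_I2)
      fix x
      have "((\<lambda>s. (f (exp_ad br (s *\<^sub>R e i) x) - f x) / s) \<longlongrightarrow> along i f x) (at 0)"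
        using deriv[of x 0] by (simp add: has_field_derivative_iff exp_ad_zero)
      moreover have "filterlim t (at 0) sequentially"
        using t0 t by (auto simp: filterlim_at less_imp_neq[symmetric])
      ultimately show "(\<lambda>n. q n x) \<longlonglongrightarrow> along i f x"
        unfolding q_def by (rule filterlim_compose)
    qed
    show "AE x in m. norm (q n x) \<le> B" for n
      using AE_sphere
    proof eventually_elim
      fix x assume x: "x \<in> sphere"
      \<comment> \<open>The intermediate point is again on the sphere, so the bound \<open>B\<close>
        serves all \<open>n\<close> at once.\<close>
      obtain s where "f (exp_ad br (t n *\<^sub>R e i) x) - f (exp_ad br (0 *\<^sub>R e i) x)
          = (t n - 0) * along i f (exp_ad br (s *\<^sub>R e i) x)"
        using MVT2[OF t[of n] deriv[of x]] by blast
      then have "q n x = along i f (exp_ad br (s *\<^sub>R e i) x)"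
        using t[of n] by (simp add: q_def exp_ad_zero)
      then show "norm (q n x) \<le> B"
        using B[OF exp_ad_sphere[OF x]] by simp
    qed
  qed
  moreover have "(\<integral>x. q n x \<partial>m) = 0" for n
    unfolding q_def
    by (simp add: integrable_continuous cont cont_exp integral_exp_ad)
  ultimately show ?thesis
    by (simp add: LIMSEQ_const_iff)
qed

text \<open>The largest open null set is invariant under the group, so it misses the orbit altogether.\<close>

lemma open_null_disjoint_orbit:
  assumes "open W" "emeasure m W = 0" "x \<in> coadjoint_orbit br \<mu>\<^sub>0"
  shows "x \<notin> W"
proof -
  define N where "N = \<Union>{W. open W \<and> emeasure m W = 0}"
  have "open N"
    unfolding N_def by auto
  \<comment> \<open>Lindelof's theorem extracts a countable subfamily, which makes the union of all
    open null sets a null set.\<close>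
  obtain \<W> where \<W>: "\<W> \<subseteq> {W. open W \<and> emeasure m W = 0}" "countable \<W>" "\<Union>\<W> = N"
    using Lindelof[of "{W. open W \<and> emeasure m W = 0}"] unfolding N_def by auto
  have "\<Union>\<W> \<in> null_sets m"
    using \<W> by (intro null_sets_UN'[of \<W> "\<lambda>W. W", simplified]) (auto simp: null_sets_def sets_m)
  then have null: "N \<in> null_sets m"
    by (simp add: \<W>)
  have inv: "y \<in> N" if "exp_ad br \<xi> y \<in> N" for \<xi> y
  proof -
    \<comment> \<open>By invariance of the measure the preimage of \<open>N\<close> is null, and it
      is open; maximality of \<open>N\<close> then absorbs it.\<close>
    have "emeasure m (exp_ad br \<xi> -` N) = emeasure (distr m borel (exp_ad br \<xi>)) N"
      using \<open>open N\<close> by (simp add: emeasure_distr[OF exp_ad_measurable_m] space_m)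
    then have "emeasure m (exp_ad br \<xi> -` N) = 0"
      using null by (simp add: distr_exp_ad null_sets_def)
    moreover have "open (exp_ad br \<xi> -` N)"
      using continuous_on_exp_ad \<open>open N\<close> by (intro open_vimage) auto
    ultimately have "exp_ad br \<xi> -` N \<subseteq> N"
      unfolding N_def by blast
    with that show ?thesis by blast
  qed
  have forth: "y \<in> N \<Longrightarrow> exp_ad br \<xi> y \<in> N" for \<xi> y
    using inv[of "- \<xi>" "exp_ad br \<xi> y"] by (simp add: exp_ad_minus)
  have same: "y \<in> N \<longleftrightarrow> \<mu>\<^sub>0 \<in> N" if "y \<in> coadjoint_orbit br \<mu>\<^sub>0" for y
    using that
  proof induction
    case (step y \<xi>)
    then show ?case
      using inv[of \<xi> y] forth[of y \<xi>] by blast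
  qed simp
  have "\<mu>\<^sub>0 \<notin> N"
  proof
    assume base: "\<mu>\<^sub>0 \<in> N"
    \<comment> \<open>Otherwise the whole orbit, which carries the measure, would lie in a null set,
      and the measure would vanish.\<close>
    have "AE y in m. y \<in> N"
      using AE_orbit by eventually_elim (simp add: same base)
    moreover have "AE y in m. y \<notin> N"
      by (rule AE_not_in[OF null])
    ultimately have "AE y in m. False"
      by eventually_elim simp
    then show False
      using emeasure_UNIV by (simp add: AE_iff_measurable[OF _ refl] space_m)
  qed
  with same assms show ?thesis
    unfolding N_def by blast
qed

end

section \<open>Stationary solutions and uniqueness of the Gibbs density\<close>

lemma fp_solution_stationary_iff:
  "fp_solution_on br h \<theta> C \<Phi> S (\<lambda>t. P) \<longleftrightarrow>
    C2 P \<and> (\<forall>x\<in>S. fp_operator br h \<theta> C \<Phi> P x = 0)"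
proof
  assume sol: "fp_solution_on br h \<theta> C \<Phi> S (\<lambda>t. P)"
  have "fp_operator br h \<theta> C \<Phi> P x = 0" if "x \<in> S" for x
  proof -
    have "\<forall>t\<ge>0. \<forall>\<mu>\<in>S. \<exists>d. ((\<lambda>s. P \<mu>) has_real_derivative d) (at t within {0..}) \<and>
        d + fp_operator br h \<theta> C \<Phi> P \<mu> = 0"
      using sol unfolding fp_solution_on_def by (rule conjunct2)
    from this[rule_format, OF order_refl that]
    obtain d where d: "((\<lambda>s. P x) has_real_derivative d) (at 0 within {0..})"
      "d + fp_operator br h \<theta> C \<Phi> P x = 0"
      by (elim exE conjE)
    \<comment> \<open>At time 0 the derivative is one-sided, but the right-hand filter is
      nontrivial, so the limit of the zero quotients is unique.\<close>
    have "d = 0"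
      using d(1) by (simp add: has_field_derivative_iff at_within_Ici_at_right tendsto_const_iff)
    with d(2) show ?thesis by simp
  qed
  moreover have "C2 P"
    using sol unfolding fp_solution_on_def by (elim conjE) (drule spec[of _ 0], simp)
  ultimately show "C2 P \<and> (\<forall>x\<in>S. fp_operator br h \<theta> C \<Phi> P x = 0)"
    by blast
next
  assume "C2 P \<and> (\<forall>x\<in>S. fp_operator br h \<theta> C \<Phi> P x = 0)"
  then show "fp_solution_on br h \<theta> C \<Phi> S (\<lambda>t. P)"
    unfolding fp_solution_on_def by (intro conjI allI impI ballI exI[of _ 0]) simp_all
qed

lemma invariant_distribution_iff:
  "invariant_distribution_on br h \<theta> C \<Phi> S m P \<longleftrightarrow>
    C2 P \<and> (\<forall>x\<in>S. fp_operator br h \<theta> C \<Phi> P x = 0) \<and> integrable m P \<and> (\<integral>x. P x \<partial>m) = 1"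
  by (simp only: invariant_distribution_on_def fp_solution_stationary_iff conj_assoc)

locale orbit_dissipative_system =
  dissipative_system br e h \<theta> \<sigma> \<Phi> + orbit_integration br e "{1..DIM('g)}" \<mu>\<^sub>0 m
  for br :: "'g::euclidean_space \<Rightarrow> 'g \<Rightarrow> 'g" and e h \<theta> \<sigma> \<Phi> \<mu>\<^sub>0 m
begin

text \<open>In the integrated \<open>energy_identity\<close> the derivatives of \<open>W\<close>
  contribute nothing, which leaves a nonnegative continuous function with zero integral.\<close>

lemma along_zero_on_orbit:
  assumes u: "C2 u" and fp: "\<And>x. x \<in> coadjoint_orbit br \<mu>\<^sub>0 \<Longrightarrow> fp (\<lambda>y. gibbs y * u y) x = 0"
    and "i \<in> {1..DIM('g)}" "x \<in> coadjoint_orbit br \<mu>\<^sub>0"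
  shows "along i u x = 0"
proof -
  define S where "S x = (\<Sum>i\<in>{1..DIM('g)}. gibbs x * (along i u x)\<^sup>2)" for x
  have cont_u: "continuous_on UNIV (along i u)" for i
    by (intro continuous_along C2_imp_C1 u)
  have cont: "continuous_on UNIV S"
    unfolding S_def
    by (intro continuous_on_sum continuous_on_mult continuous_on_power cont_u
        C1_continuous C2_imp_C1 C2_gibbs)
  obtain W where W: "\<And>i. C1 (W i)"
    "\<And>x. u x * fp (\<lambda>y. gibbs y * u y) x = (\<Sum>i\<in>{1..DIM('g)}. along i (W i) x) + \<sigma>\<^sup>2 / 2 * S x"
    by (rule that[OF energy_identity(2)[OF u] energy_identity(1)[OF u, folded S_def]])
  have "AE x in m. \<sigma>\<^sup>2 / 2 * S x = - (\<Sum>i\<in>{1..DIM('g)}. along i (W i) x)"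
    using AE_orbit
  proof eventually_elim
    fix x assume "x \<in> coadjoint_orbit br \<mu>\<^sub>0"
    then show "\<sigma>\<^sup>2 / 2 * S x = - (\<Sum>i\<in>{1..DIM('g)}. along i (W i) x)"
      using W(2)[of x] fp by simp
  qed
  moreover have "continuous_on UNIV (\<lambda>x. \<Sum>i\<in>{1..DIM('g)}. along i (W i) x)"
    by (intro continuous_on_sum continuous_along W)
  ultimately have "(\<integral>x. \<sigma>\<^sup>2 / 2 * S x \<partial>m) = (\<integral>x. - (\<Sum>i\<in>{1..DIM('g)}. along i (W i) x) \<partial>m)"
    by (intro integral_cong_AE continuous_measurable_m continuous_on_mult continuous_on_const
        continuous_on_minus continuous_on_sum continuous_along W(1) cont)
  also have "\<dots> = 0"
    by (simp add: integrable_continuous continuous_along W integral_along)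
  finally have "(\<integral>x. S x \<partial>m) = 0"
    using sigma_nz by simp
  moreover have "S x \<ge> 0" for x
    by (simp add: S_def sum_nonneg)
  ultimately have "AE x in m. S x = 0"
    using integral_nonneg_eq_0_iff_AE[OF integrable_continuous[OF cont]] by simp
  \<comment> \<open>Openness upgrades vanishing almost everywhere to vanishing at every point of the
    orbit.\<close>
  moreover have open_S: "open {x. S x \<noteq> 0}"
    by (intro open_Collect_neq cont continuous_on_const)
  ultimately have "emeasure m {x. S x \<noteq> 0} = 0"
    by (subst (asm) AE_iff_measurable[OF _ refl]) (auto simp: space_m sets_m)
  then have "S x = 0"
    using open_null_disjoint_orbit[OF open_S] assms(4) by blast
  then show ?thesis
    using assms(3) by (simp add: S_def sum_nonneg_eq_0_iff)
qed

lemma integral_gibbs_pos: "(\<integral>x. gibbs x \<partial>m) > 0"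
proof -
  have int: "integrable m gibbs"
    by (intro integrable_continuous C1_continuous C2_imp_C1 C2_gibbs)
  have "(\<integral>x. gibbs x \<partial>m) \<noteq> 0"
  proof
    assume "(\<integral>x. gibbs x \<partial>m) = 0"
    then have "AE x in m. False"
      using integral_nonneg_eq_0_iff_AE[OF int] by simp
    then show False
      using emeasure_UNIV by (simp add: AE_iff_measurable[OF _ refl] space_m)
  qed
  moreover have "(\<integral>x. gibbs x \<partial>m) \<ge> 0"
    by (intro integral_nonneg_AE) simp
  ultimately show ?thesis
    by linarith
qed

lemma invariant_distribution_gibbs:
  "\<exists>Z>0. invariant_distribution_on br h \<theta> (killing_casimir br) \<Phi> (coadjoint_orbit br \<mu>\<^sub>0) m
        (\<lambda>x. inverse Z * gibbs x) \<and>
      (\<forall>P. invariant_distribution_on br h \<theta> (killing_casimir br) \<Phi> (coadjoint_orbit br \<mu>\<^sub>0) m P \<longrightarrow>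
        (\<forall>x\<in>coadjoint_orbit br \<mu>\<^sub>0. P x = inverse Z * gibbs x))"
proof (intro exI[of _ "\<integral>x. gibbs x \<partial>m"] conjI allI impI ballI integral_gibbs_pos)
  let ?Z = "\<integral>x. gibbs x \<partial>m"
  have int: "integrable m gibbs"
    by (intro integrable_continuous C1_continuous C2_imp_C1 C2_gibbs)
  have "fp (\<lambda>x. inverse ?Z * gibbs x) x = 0" for x
    using fp_gibbs[of "inverse ?Z"] by (simp only: mult.commute)
  moreover have "C2 (\<lambda>x. inverse ?Z * gibbs x)"
    by (intro C2_mult C2_const C2_gibbs)
  moreover have "integrable m (\<lambda>x. inverse ?Z * gibbs x)" "(\<integral>x. inverse ?Z * gibbs x \<partial>m) = 1"
    using int integral_gibbs_pos by (simp_all only: integrable_mult_right integral_mult_right_zero) simp_all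
  ultimately show "invariant_distribution_on br h \<theta> (killing_casimir br) \<Phi> (coadjoint_orbit br \<mu>\<^sub>0) m
        (\<lambda>x. inverse ?Z * gibbs x)"
    by (simp only: invariant_distribution_iff) simp
next
  let ?Z = "\<integral>x. gibbs x \<partial>m"
  fix P x
  assume P: "invariant_distribution_on br h \<theta> (killing_casimir br) \<Phi> (coadjoint_orbit br \<mu>\<^sub>0) m P"
    and x: "x \<in> coadjoint_orbit br \<mu>\<^sub>0"
  \<comment> \<open>The ratio of \<open>P\<close> to the Gibbs factor, whose derivatives along the
    orbit are to be shown zero.\<close>
  define u where "u x = P x * exp (2 * \<theta> / \<sigma>\<^sup>2 * h x)" for x
  have Pu: "P = (\<lambda>y. gibbs y * u y)"
    by (simp add: fun_eq_iff u_def exp_minus field_simps)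
  have C2u: "C2 u"
    using P unfolding u_def invariant_distribution_iff by (intro C2_mult C2_exp_scaled C2_h) simp
  have "fp (\<lambda>y. gibbs y * u y) y = 0" if "y \<in> coadjoint_orbit br \<mu>\<^sub>0" for y
    using P that unfolding invariant_distribution_iff Pu[symmetric] by simp
  then have "along i u y = 0" if "i \<in> {1..DIM('g)}" "y \<in> coadjoint_orbit br \<mu>\<^sub>0" for i y
    using along_zero_on_orbit[OF C2u] that by blast
  then have const: "u y = u \<mu>\<^sub>0" if "y \<in> coadjoint_orbit br \<mu>\<^sub>0" for y
    using constant_on_orbit[OF C2_imp_C1[OF C2u]] that by blast
  \<comment> \<open>Only the constant value of \<open>u\<close> is still free; integrating and using
    normalisation fixes it as \<open>inverse ?Z\<close>.\<close>
  have "AE y in m. P y = u \<mu>\<^sub>0 * gibbs y"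
    using AE_orbit by eventually_elim (simp only: Pu const mult.commute)
  then have "(\<integral>y. P y \<partial>m) = (\<integral>y. u \<mu>\<^sub>0 * gibbs y \<partial>m)"
    by (intro integral_cong_AE continuous_measurable_m continuous_on_mult continuous_on_const
        C1_continuous C2_imp_C1 C2_gibbs) (use P in \<open>auto simp: invariant_distribution_iff\<close>)
  then have "u \<mu>\<^sub>0 * ?Z = 1"
    using P by (simp add: invariant_distribution_iff)
  then have "u \<mu>\<^sub>0 = inverse ?Z"
    using inverse_unique[of ?Z "u \<mu>\<^sub>0"] by (simp only: mult.commute)
  then show "P x = inverse ?Z * gibbs x"
    by (simp only: Pu const[OF x] mult.commute)
qed

end

text \<open>The first conjunct ties \<open>fp_operator\<close> to the stochastic equation, so that
  the second concerns the equation's own densities. Rescaling \<open>m\<close> rescales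
  \<open>Z\<close>, and densities are compared on the orbit only.\<close>

theorem theorem2p2:
  fixes br :: "'g::euclidean_space \<Rightarrow> 'g \<Rightarrow> 'g"
    and h :: "'g \<Rightarrow> real"
    and \<theta> \<sigma> :: real
    and e s :: "nat \<Rightarrow> 'g"
    and \<Phi> :: "nat \<Rightarrow> 'g \<Rightarrow> real"
    and C :: "'g \<Rightarrow> real"
  assumes semisimple: "semisimple_lie_algebra br"
    and hamiltonian: "C2 h"
    and theta: "\<theta> > 0"
    and sigma: "\<sigma> \<noteq> 0"
    and e_span: "span (e ` {1..DIM('g)}) = UNIV"
    and e_normalised: "\<And>i j. i \<in> {1..DIM('g)} \<Longrightarrow> j \<in> {1..DIM('g)} \<Longrightarrow>
           killing br (e i) (e j) = (if i = j then - 4 else 0)"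
    and amplitudes: "\<And>i. i \<in> {1..DIM('g)} \<Longrightarrow> s i = \<sigma> *\<^sub>R e i"
    and potentials_differentiable: "\<And>i \<mu>. i \<in> {1..DIM('g)} \<Longrightarrow> \<Phi> i differentiable (at \<mu>)"
    and potentials: "\<And>i \<mu>. i \<in> {1..DIM('g)} \<Longrightarrow> s i = - grad br (\<Phi> i) \<mu>"
    and casimir: "C = killing_casimir br"
  shows
    "(\<forall>P \<mu>. C2 P \<longrightarrow>
        stratonovich_fokker_planck (sep_drift br h \<theta> C) (sep_noise br s) DIM('g) P \<mu>
          = - fp_operator br h \<theta> C \<Phi> P \<mu>)
     \<and>
     (\<forall>\<mu>\<^sub>0 m. orbit_measure br (coadjoint_orbit br \<mu>\<^sub>0) m \<longrightarrow>
        (\<exists>Z>0.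
           invariant_distribution_on br h \<theta> C \<Phi> (coadjoint_orbit br \<mu>\<^sub>0) m
             (\<lambda>\<mu>. inverse Z * exp (- (2 * \<theta> / \<sigma>\<^sup>2) * h \<mu>)) \<and>
           (\<forall>P. invariant_distribution_on br h \<theta> C \<Phi> (coadjoint_orbit br \<mu>\<^sub>0) m P \<longrightarrow>
             (\<forall>\<mu>\<in>coadjoint_orbit br \<mu>\<^sub>0. P \<mu> = inverse Z * exp (- (2 * \<theta> / \<sigma>\<^sup>2) * h \<mu>)))))"
proof -
  have frame: "dissipative_system br e h \<sigma> \<Phi>"
  proof
    show "lie_algebra br"
      using semisimple by (simp add: semisimple_lie_algebra_def)
    show "grad br (\<Phi> i) x = - (\<sigma> *\<^sub>R e i)" if "i \<in> {1..DIM('g)}" for i x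
      using potentials[OF that, of x] amplitudes[OF that] by simp
  qed (use e_span e_normalised hamiltonian sigma in auto)
  have "\<exists>Z>0. invariant_distribution_on br h \<theta> C \<Phi> (coadjoint_orbit br \<mu>\<^sub>0) m
        (\<lambda>\<mu>. inverse Z * exp (- (2 * \<theta> / \<sigma>\<^sup>2) * h \<mu>)) \<and>
      (\<forall>P. invariant_distribution_on br h \<theta> C \<Phi> (coadjoint_orbit br \<mu>\<^sub>0) m P \<longrightarrow>
        (\<forall>\<mu>\<in>coadjoint_orbit br \<mu>\<^sub>0. P \<mu> = inverse Z * exp (- (2 * \<theta> / \<sigma>\<^sup>2) * h \<mu>)))"
    if m: "orbit_measure br (coadjoint_orbit br \<mu>\<^sub>0) m" for \<mu>\<^sub>0 m
  proof -
    interpret dissipative_system br e h \<theta> \<sigma> \<Phi>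
      by (rule frame)
    interpret orbit_dissipative_system br e h \<theta> \<sigma> \<Phi> \<mu>\<^sub>0 m
      by unfold_locales (rule m)
    show ?thesis
      unfolding casimir by (rule invariant_distribution_gibbs)
  qed
  then show ?thesis
    using dissipative_system.stratonovich_fokker_planck_eq[OF frame _ amplitudes, folded casimir]
    by blast
qed

end
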